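(* Let $p$ be an odd prime, let $G$ be a quasi-powerful $p$-group and let $i$ be a non-negative integer. Then: (i) if $a,b\in G$ both have order at most $p^{i}$, then their product $ab$ has order at most $p^{i}$; (ii) $G^{p^{i}}=\{g^{p^{i}}\mid g\in G\}$, i.e. the subgroup generated by the $p^{i}$th powers coincides with the set of $p^{i}$th powers; (iii) $|G:G^{p^{i}}|=|\Omega_{i}(G)|$. In particular, $G$ has a regular power structure.
   Context: For an odd prime $p$, a finite $p$-group $G$ is powerful if $[G,G]\le G^{p}$, and $G$ is quasi-powerful if $G/Z(G)$ is powerful. For a finite $p$-group $G$, $G^{p^{i}}=\langle g^{p^{i}}\mid g\in G\rangle$ and $\Omega_{i}(G)=\langle g\in G\mid g^{p^{i}}=1\rangle$. A finite $p$-group $G$ has a regular power structure if for all positive integers $i$: $G^{p^{i}}=\{g^{p^{i}}\mid g\in G\}$, $\Omega_{i}(G)=\{g\in G\mid o(g)\le p^{i}\}$, and $|G:G^{p^{i}}|=|\Omega_{i}(G)|$. *)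

theory Defs
  imports "HOL-Algebra.Algebra" "HOL-Algebra.Multiplicative_Group"
begin

definition pow_subgroup :: "('a, 'b) monoid_scheme \<Rightarrow> nat \<Rightarrow> 'a set" where
  "pow_subgroup G k = generate G {g [^]\<^bsub>G\<^esub> k | g. g \<in> carrier G}"

text \<open>Omega_i(G), with k = p^i: the subgroup generated by elements g with g^k = 1.\<close>
definition Omega :: "('a, 'b) monoid_scheme \<Rightarrow> nat \<Rightarrow> 'a set" where
  "Omega G k = generate G {g \<in> carrier G. g [^]\<^bsub>G\<^esub> k = \<one>\<^bsub>G\<^esub>}"

definition group_center :: "('a, 'b) monoid_scheme \<Rightarrow> 'a set" where
  "group_center G = {z \<in> carrier G. \<forall>g \<in> carrier G. z \<otimes>\<^bsub>G\<^esub> g = g \<otimes>\<^bsub>G\<^esub> z}"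

definition p_group :: "nat \<Rightarrow> ('a, 'b) monoid_scheme \<Rightarrow> bool" where
  "p_group p G \<longleftrightarrow> group G \<and> finite (carrier G) \<and> (\<exists>n. order G = p ^ n)"

definition powerful :: "nat \<Rightarrow> ('a, 'b) monoid_scheme \<Rightarrow> bool" where
  "powerful p G \<longleftrightarrow> derived G (carrier G) \<subseteq> pow_subgroup G p"

definition quasi_powerful :: "nat \<Rightarrow> ('a, 'b) monoid_scheme \<Rightarrow> bool" where
  "quasi_powerful p G \<longleftrightarrow> powerful p (G Mod group_center G)"

definition regular_power_structure :: "nat \<Rightarrow> ('a, 'b) monoid_scheme \<Rightarrow> bool" where
  "regular_power_structure p G \<longleftrightarrow>
     (\<forall>i::nat. i > 0 \<longrightarrow>
        pow_subgroup G (p ^ i) = {g [^]\<^bsub>G\<^esub> (p ^ i) | g. g \<in> carrier G} \<and>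
        Omega G (p ^ i) = {g \<in> carrier G. group.ord G g \<le> p ^ i} \<and>
        card (rcosets\<^bsub>G\<^esub> (pow_subgroup G (p ^ i))) = card (Omega G (p ^ i)))"

end

theory Submission
  imports Defs
begin

text \<open>
  Put \<open>M = G\<^sup>p Z\<close> with \<open>Z\<close> the centre. Then \<open>[G,G] \<le> M\<close>, and \<open>[M,G] \<le> M\<^sup>p\<close> follows by descending
  along a central series. Hence every subgroup \<open>\<langle>u\<rangle>M\<close> satisfies the hypothesis of the theorem again
  (with the same \<open>Z\<close>), and it is proper unless \<open>G\<close> is abelian, which permits induction on \<open>|G|\<close>.
  The only commutator calculation is that \<open>(ab)\<^sup>p\<close> and \<open>a\<^sup>p b\<^sup>p\<close> agree modulo a normal subgroup
  containing \<open>[s,a]\<close>, \<open>[s,b]\<close> and \<open>s\<^sup>p\<close>, where \<open>s = [b,a]\<close> and \<open>p\<close> is odd.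

  For the orders of products, let \<open>P\<^sub>1 = M\<close> and \<open>P\<^sub>k\<^sub>+\<^sub>1 = P\<^sub>k\<^sup>p\<close>. A reverse induction on \<open>k\<close>, combined with the
  induction on \<open>|G|\<close>, shows that an element of order \<open>p\<close> in \<open>P\<^sub>k\<close> commutes with every \<open>x\<close> with
  \<open>x\<^bsup>p^k\<^esup> \<in> Z\<close>; from this one compares \<open>p^i\<close>-th powers modulo the elements of \<open>M\<close> whose order divides
  \<open>p^(i-1)\<close>. For the index, \<open>x \<mapsto> x\<^bsup>p^i\<^esup>\<close> is a homomorphism modulo \<open>P\<^sub>i\<^sub>+\<^sub>1\<close>, and counting in the subgroups
  \<open>\<langle>x\<rangle>M\<close> identifies its kernel as \<open>M \<Omega>\<^sub>i(G)\<close>.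
\<close>

section \<open>Commutators and counting\<close>

text \<open>With this convention x^g = x[x,g], which is the form in which conjugation enters
  below.\<close>

definition cmt :: "('a, 'b) monoid_scheme \<Rightarrow> 'a \<Rightarrow> 'a \<Rightarrow> 'a" where
  "cmt G x y = inv\<^bsub>G\<^esub> x \<otimes>\<^bsub>G\<^esub> inv\<^bsub>G\<^esub> y \<otimes>\<^bsub>G\<^esub> x \<otimes>\<^bsub>G\<^esub> y"

context group
begin

lemma mult_inv_cancel [simp]:
  "x \<in> carrier G \<Longrightarrow> y \<in> carrier G \<Longrightarrow> x \<otimes> (inv x \<otimes> y) = y"
  "x \<in> carrier G \<Longrightarrow> y \<in> carrier G \<Longrightarrow> inv x \<otimes> (x \<otimes> y) = y"
  by (simp_all flip: m_assoc)

lemmas word_simps = cmt_def m_assoc inv_mult_group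

lemma cmt_closed [intro, simp]: "x \<in> carrier G \<Longrightarrow> y \<in> carrier G \<Longrightarrow> cmt G x y \<in> carrier G"
  by (simp add: cmt_def)

lemma cmt_self [simp]: "x \<in> carrier G \<Longrightarrow> cmt G x x = \<one>"
  by (simp add: word_simps)

lemma conj_eq_mult_cmt:
  "x \<in> carrier G \<Longrightarrow> g \<in> carrier G \<Longrightarrow> inv g \<otimes> x \<otimes> g = x \<otimes> cmt G x g"
  by (simp add: word_simps)

lemma cmt_eq_one_iff:
  assumes "x \<in> carrier G" "y \<in> carrier G"
  shows "cmt G x y = \<one> \<longleftrightarrow> x \<otimes> y = y \<otimes> x"
proof -
  have "x \<otimes> y = y \<otimes> x \<otimes> cmt G x y" using assms by (simp add: word_simps)
  moreover have "y \<otimes> x \<otimes> cmt G x y = y \<otimes> x \<longleftrightarrow> cmt G x y = \<one>"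
    using assms by simp
  ultimately show ?thesis by metis
qed

lemma conj_pow:
  fixes n :: nat
  assumes "x \<in> carrier G" "g \<in> carrier G"
  shows "(inv g \<otimes> x \<otimes> g) [^] n = inv g \<otimes> x [^] n \<otimes> g"
  by (induction n) (use assms in \<open>simp_all add: m_assoc\<close>)

lemma nat_pow_commute:
  fixes k :: nat
  assumes "x \<in> carrier G" "y \<in> carrier G" "x \<otimes> y = y \<otimes> x"
  shows "x [^] k \<otimes> y = y \<otimes> x [^] k"
proof (induction k)
  case (Suc k)
  have "x [^] Suc k \<otimes> y = x [^] k \<otimes> y \<otimes> x" using assms by (simp add: m_assoc)
  then show ?case using assms Suc by (simp add: m_assoc)
qed (use assms in simp)

text \<open>In the induction the new factor \<open>a\<close> moves left past \<open>b [^] n\<close>,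
  which costs \<open>s [^] n\<close>; the exponents 0, 1, ..., n-1 add up to n(n-1)/2.\<close>

lemma class2_pow:
  fixes n :: nat
  assumes [simp]: "a \<in> carrier G" "b \<in> carrier G" "s \<in> carrier G"
    and ba: "b \<otimes> a = a \<otimes> b \<otimes> s" and sa: "s \<otimes> a = a \<otimes> s" and sb: "s \<otimes> b = b \<otimes> s"
  shows "(a \<otimes> b) [^] n = a [^] n \<otimes> b [^] n \<otimes> s [^] (n * (n - 1) div 2)"
proof (induction n)
  case (Suc n)
  have ba': "b [^] k \<otimes> a = a \<otimes> b [^] k \<otimes> s [^] k" for k :: nat
  proof (induction k)
    case (Suc k)
    have "b [^] Suc k \<otimes> a = b [^] k \<otimes> a \<otimes> (b \<otimes> s)"
      using ba by (simp add: m_assoc)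
    also have "\<dots> = a \<otimes> b [^] k \<otimes> (s [^] k \<otimes> b) \<otimes> s" by (simp add: Suc m_assoc)
    also have "\<dots> = a \<otimes> b [^] k \<otimes> (b \<otimes> s [^] k) \<otimes> s" using nat_pow_commute[of s b k] sb by simp
    finally show ?case by (simp add: m_assoc)
  qed simp
  define t where "t = n * (n - 1) div 2"
  have t: "Suc n * (Suc n - 1) div 2 = n + t"
    unfolding t_def by (cases n) (auto simp: algebra_simps)
  have "(a \<otimes> b) [^] Suc n = a [^] n \<otimes> b [^] n \<otimes> (s [^] t \<otimes> a) \<otimes> b"
    by (simp add: Suc t_def m_assoc)
  also have "\<dots> = a [^] n \<otimes> b [^] n \<otimes> (a \<otimes> s [^] t) \<otimes> b" using nat_pow_commute[of s a t] sa by simp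
  also have "\<dots> = a [^] n \<otimes> (b [^] n \<otimes> a) \<otimes> (s [^] t \<otimes> b)" by (simp add: m_assoc)
  also have "\<dots> = a [^] n \<otimes> (a \<otimes> b [^] n \<otimes> s [^] n) \<otimes> (b \<otimes> s [^] t)"
    using nat_pow_commute[of s b t] sb ba' by simp
  also have "\<dots> = a [^] Suc n \<otimes> b [^] n \<otimes> (s [^] n \<otimes> b) \<otimes> s [^] t" by (simp add: m_assoc)
  also have "\<dots> = a [^] Suc n \<otimes> b [^] n \<otimes> (b \<otimes> s [^] n) \<otimes> s [^] t"
    using nat_pow_commute[of s b n] sb by simp
  also have "\<dots> = a [^] Suc n \<otimes> b [^] Suc n \<otimes> s [^] (n + t)"
    by (simp add: m_assoc flip: nat_pow_mult)
  finally show ?case using t by simp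
qed simp

lemma commuting_pow:
  fixes n :: nat
  assumes "a \<in> carrier G" "b \<in> carrier G" "a \<otimes> b = b \<otimes> a"
  shows "(a \<otimes> b) [^] n = a [^] n \<otimes> b [^] n"
  using class2_pow[of a b \<one> n] assms by simp

lemma mult_inv_eq_one_iff:
  assumes "x \<in> carrier G" "y \<in> carrier G"
  shows "x \<otimes> inv y = \<one> \<longleftrightarrow> x = y"
proof
  assume "x \<otimes> inv y = \<one>"
  then have "x \<otimes> inv y \<otimes> y = y" using assms by simp
  then show "x = y" using assms by (simp add: m_assoc)
qed (use assms in simp)

lemma subgroup_pow_closed:
  fixes n :: nat
  shows "subgroup H G \<Longrightarrow> x \<in> H \<Longrightarrow> x [^] n \<in> H"
  by (induction n) (auto simp: subgroup.one_closed subgroup.m_closed)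

lemma cmt_consistent:
  assumes "subgroup H G" "x \<in> H" "y \<in> H"
  shows "cmt (G\<lparr>carrier := H\<rparr>) x y = cmt G x y"
  using assms by (simp add: cmt_def)

lemma normalI_conj:
  assumes "subgroup N G" "\<And>n g. n \<in> N \<Longrightarrow> g \<in> carrier G \<Longrightarrow> inv g \<otimes> n \<otimes> g \<in> N"
  shows "N \<lhd> G"
proof -
  have "g \<otimes> n \<otimes> inv g \<in> N" if "n \<in> N" "g \<in> carrier G" for n g
    using assms(2)[of n "inv g"] that by simp
  then show ?thesis using assms(1) by (simp add: normal_inv_iff)
qed

lemma pow_set_subgroup:
  fixes k :: nat
  assumes H: "subgroup H G" and m: "\<And>x y. x \<in> H \<Longrightarrow> y \<in> H \<Longrightarrow> \<exists>z\<in>H. x [^] k \<otimes> y [^] k = z [^] k"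
  shows "subgroup {x [^] k | x. x \<in> H} G"
proof (rule subgroupI)
  interpret H: subgroup H G by fact
  show "{x [^] k | x. x \<in> H} \<subseteq> carrier G" by auto
  show "{x [^] k | x. x \<in> H} \<noteq> {}" using H.one_closed by blast
  show "inv a \<in> {x [^] k | x. x \<in> H}" if "a \<in> {x [^] k | x. x \<in> H}" for a
    using that by (auto simp: nat_pow_inv[symmetric])
  show "a \<otimes> b \<in> {x [^] k | x. x \<in> H}" if "a \<in> {x [^] k | x. x \<in> H}" "b \<in> {x [^] k | x. x \<in> H}" for a b
    using that m by auto
qed

text \<open>Only the fibres of \<open>f\<close> matter: each is a translate of \<open>K\<close>.
  This form covers conjugacy classes, cosets and power maps at once.\<close>

lemma card_eq_kernel_times_image:
  assumes A: "subgroup A G" "finite A" and K: "K \<subseteq> A"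
    and f: "\<And>a b. a \<in> A \<Longrightarrow> b \<in> A \<Longrightarrow> f a = f b \<longleftrightarrow> a \<otimes> inv b \<in> K"
  shows "card A = card K * card (f ` A)"
proof -
  interpret A: subgroup A G by fact
  have fib: "card {a \<in> A. f a = y} = card K" if "y \<in> f ` A" for y
  proof -
    from that obtain b where b: "b \<in> A" "y = f b" by auto
    have "bij_betw (\<lambda>k. k \<otimes> b) K {a \<in> A. f a = y}"
      by (rule bij_betw_byWitness[where f' = "\<lambda>a. a \<otimes> inv b"])
        (use b K in \<open>auto simp: f m_assoc subset_iff\<close>)
    then show ?thesis by (simp add: bij_betw_same_card)
  qed
  have "card A = (\<Sum>y\<in>f ` A. card {a \<in> A. f a = y})"
    using sum.image_gen[OF A(2), of "\<lambda>_. 1 :: nat" f] by simp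
  also have "\<dots> = card (f ` A) * card K" using fib by simp
  finally show ?thesis by simp
qed

lemma coset_eq_iff:
  assumes "subgroup N G" "a \<in> carrier G" "b \<in> carrier G"
  shows "N #> a = N #> b \<longleftrightarrow> a \<otimes> inv b \<in> N"
proof -
  interpret subgroup N G by fact
  have "N #> a = N #> b \<longleftrightarrow> a \<in> N #> b"
    using assms rcos_self[of a N] repr_independence[of a N b] by metis
  also have "\<dots> \<longleftrightarrow> a \<otimes> inv b \<in> N"
    using assms rcos_module[OF is_group, of b a] by simp
  finally show ?thesis .
qed

lemma card_eq_inter_times_cosets:
  assumes A: "subgroup A G" "finite A" and N: "subgroup N G"
  shows "card A = card (A \<inter> N) * card ((\<lambda>a. N #> a) ` A)"
proof (rule card_eq_kernel_times_image[OF A])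
  interpret A: subgroup A G by fact
  show "N #> a = N #> b \<longleftrightarrow> a \<otimes> inv b \<in> A \<inter> N" if "a \<in> A" "b \<in> A" for a b
    using that N by (simp add: coset_eq_iff)
qed auto

text \<open>Class equation inside \<open>K\<close>: if only \<one> were central, every other class
  in \<open>K\<close> would have size divisible by \<open>p\<close>. As \<open>p\<close> divides
  |K|, it would divide the size 1 of the remaining class.\<close>

lemma normal_meets_center:
  assumes p: "Factorial_Ring.prime (p::nat)" and fin: "finite (carrier G)" and ord: "order G = p ^ n"
    and K: "K \<lhd> G" "K \<noteq> {\<one>}"
  obtains k where "k \<in> K" "k \<noteq> \<one>" "\<And>g. g \<in> carrier G \<Longrightarrow> k \<otimes> g = g \<otimes> k"
proof -
  interpret K: normal K G by fact
  define orb where "orb k = (\<lambda>g. inv g \<otimes> k \<otimes> g) ` carrier G" for k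
  have Kc: "k \<in> carrier G" if "k \<in> K" for k using that by simp
  have finK: "finite K" using fin K.subset finite_subset by blast
  have mem: "k \<in> orb k" if "k \<in> K" for k
    unfolding orb_def using Kc[OF that] by (auto intro!: image_eqI[of _ _ \<one>])
  have orbK: "orb k \<subseteq> K" if "k \<in> K" for k
    unfolding orb_def using that K.inv_op_closed1 by auto
  have sub: "orb l \<subseteq> orb k" if "k \<in> K" "l \<in> orb k" for k l
  proof -
    from that obtain g where g: "g \<in> carrier G" "l = inv g \<otimes> k \<otimes> g" unfolding orb_def by auto
    have "inv h \<otimes> l \<otimes> h = inv (g \<otimes> h) \<otimes> k \<otimes> (g \<otimes> h)" if "h \<in> carrier G" for h
      using that g Kc[OF \<open>k \<in> K\<close>] by (simp add: m_assoc inv_mult_group)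
    then show ?thesis unfolding orb_def using g by auto
  qed
  have sym: "k \<in> orb l" if "k \<in> K" "l \<in> orb k" for k l
  proof -
    from that obtain g where g: "g \<in> carrier G" "l = inv g \<otimes> k \<otimes> g" unfolding orb_def by auto
    then have "k = inv (inv g) \<otimes> l \<otimes> inv g" using Kc[OF that(1)] by (simp add: m_assoc)
    then show ?thesis unfolding orb_def using g by blast
  qed
  have eq: "orb l = orb k" if "k \<in> K" "l \<in> orb k" for k l
    using sub that sym orbK by (metis subset_antisym subsetD)
  have dvd_ord: "card (orb k) dvd order G" if "k \<in> K" for k
  proof -
    let ?S = "{g \<in> carrier G. g \<otimes> k = k \<otimes> g}"
    \<comment> \<open>Orbit-stabilizer: two elements conjugate \<open>k\<close> alike exactly when
      they differ by an element of its centralizer \<open>?S\<close>.\<close>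
    have "card (carrier G) = card ?S * card (orb k)"
      unfolding orb_def
    proof (rule card_eq_kernel_times_image)
      fix a b assume ab: "a \<in> carrier G" "b \<in> carrier G"
      note k = Kc[OF that]
      have "inv a \<otimes> k \<otimes> a = inv b \<otimes> k \<otimes> b \<longleftrightarrow> a \<otimes> (inv a \<otimes> k \<otimes> a) \<otimes> inv b = a \<otimes> (inv b \<otimes> k \<otimes> b) \<otimes> inv b"
        using ab k by simp
      also have "\<dots> \<longleftrightarrow> k \<otimes> (a \<otimes> inv b) = (a \<otimes> inv b) \<otimes> k"
        using ab k by (simp add: m_assoc)
      finally show "inv a \<otimes> k \<otimes> a = inv b \<otimes> k \<otimes> b \<longleftrightarrow> a \<otimes> inv b \<in> ?S"
        using ab by auto
    qed (use fin subgroup_self in auto)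
    then show ?thesis by (simp add: order_def)
  qed
  define C where "C = orb ` K"
  have one: "orb \<one> = {\<one>}" unfolding orb_def by auto
  have oneC: "{\<one>} \<in> C" unfolding C_def using one K.one_closed by (metis imageI)
  have UC: "\<Union>C = K" unfolding C_def using mem orbK by blast
  have disj: "disjoint C"
  proof (rule disjointI)
    fix A B assume "A \<in> C" "B \<in> C" "A \<noteq> B"
    then obtain k l where kl: "k \<in> K" "l \<in> K" "A = orb k" "B = orb l" unfolding C_def by auto
    show "A \<inter> B = {}"
    proof (rule ccontr)
      assume "A \<inter> B \<noteq> {}"
      then obtain x where "x \<in> orb k" "x \<in> orb l" using kl by auto
      then have "orb k = orb l" using eq[of k x] eq[of l x] kl by simp
      then show False using kl \<open>A \<noteq> B\<close> by simp
    qed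
  qed
  have finC: "finite C" "\<And>W. W \<in> C \<Longrightarrow> finite W"
    unfolding C_def using finK finite_subset[OF orbK finK] by auto
  have cK: "card K = 1 + (\<Sum>W\<in>C - {{\<one>}}. card W)"
  proof -
    have "card K = (\<Sum>W\<in>C. card W)"
      using card_Union_disjoint[of C] disj finC UC by (simp add: disjoint_def pairwise_def)
    then show ?thesis using sum.remove[OF finC(1) oneC, of card] by simp
  qed
  have "card K dvd p ^ n"
    using ord card_eq_inter_times_cosets[OF subgroup_self fin K.is_subgroup] K.subset
    by (simp add: order_def Int_absorb1 Int_absorb2) (metis dvd_triv_left)
  moreover have "card K \<noteq> 1" using K(2) K.one_closed by (metis card_1_singletonE singletonD)
  ultimately have pK: "p dvd card K"
    using p by (metis divides_primepow_nat dvd_power not_gr_zero power_0)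
  show ?thesis
  proof (rule ccontr)
    assume "\<not> thesis"
    then have *: "\<exists>g\<in>carrier G. k \<otimes> g \<noteq> g \<otimes> k" if "k \<in> K" "k \<noteq> \<one>" for k
      using that \<open>\<And>k. k \<in> K \<Longrightarrow> k \<noteq> \<one> \<Longrightarrow> (\<And>g. g \<in> carrier G \<Longrightarrow> k \<otimes> g = g \<otimes> k) \<Longrightarrow> thesis\<close> by blast
    have "p dvd card W" if "W \<in> C - {{\<one>}}" for W
    proof -
      from that obtain k where k: "k \<in> K" "W = orb k" unfolding C_def by auto
      have "k \<noteq> \<one>" using that k one by auto
      then obtain g where g: "g \<in> carrier G" "k \<otimes> g \<noteq> g \<otimes> k" using * k by blast
      have "inv g \<otimes> k \<otimes> g \<in> orb k" unfolding orb_def using g by auto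
      moreover have "inv g \<otimes> k \<otimes> g \<noteq> k"
        using g Kc[OF k(1)] by (metis inv_closed inv_solve_left m_assoc m_closed)
      ultimately have "card W \<noteq> 1" using k mem by (metis card_1_singletonE singletonD)
      moreover have "card W dvd p ^ n" using dvd_ord k ord by simp
      ultimately show ?thesis
        using p by (metis divides_primepow_nat dvd_power not_gr_zero power_0)
    qed
    then have "p dvd (\<Sum>W\<in>C - {{\<one>}}. card W)" by (intro dvd_sum) auto
    then have "p dvd 1" using pK cK by (metis dvd_add_left_iff)
    then show False using p by auto
  qed
qed

end

section \<open>Commutators and powers modulo a normal subgroup\<close>

context normal
begin

interpretation quot: group_hom G "G Mod H" "\<lambda>x. H #> x"
  by (intro group_hom.intro group_hom_axioms.intro is_group factorgroup_is_group r_coset_hom_Mod)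

lemma coset_eq_self_iff: "x \<in> carrier G \<Longrightarrow> H #> x = H \<longleftrightarrow> x \<in> H"
  by (metis coset_join1 coset_join2 subgroup_axioms subset)

lemma coset_eqE:
  assumes "H #> x = H #> y" "x \<in> carrier G" "y \<in> carrier G"
  obtains n where "n \<in> H" "x = y \<otimes> n"
proof
  have "H #> (inv y \<otimes> x) = H #> (inv y \<otimes> y)"
    using assms by (simp del: mult_FactGroup)
  also have "\<dots> = H" using assms by (simp add: coset_mult_one subset)
  finally show "inv y \<otimes> x \<in> H" using assms by (intro iffD1[OF coset_eq_self_iff]) auto
  show "x = y \<otimes> (inv y \<otimes> x)" using assms by simp
qed

lemma coset_cmt: "x \<in> carrier G \<Longrightarrow> y \<in> carrier G \<Longrightarrow>
    cmt (G Mod H) (H #> x) (H #> y) = H #> cmt G x y"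
  unfolding cmt_def by (simp del: mult_FactGroup)

lemma coset_commute_iff:
  assumes "x \<in> carrier G" "y \<in> carrier G"
  shows "cmt G x y \<in> H \<longleftrightarrow>
    (H #> x) \<otimes>\<^bsub>G Mod H\<^esub> (H #> y) = (H #> y) \<otimes>\<^bsub>G Mod H\<^esub> (H #> x)"
  using assms quot.H.cmt_eq_one_iff[of "H #> x" "H #> y"]
  by (simp add: coset_cmt coset_eq_self_iff del: mult_FactGroup)

text \<open>In the quotient \<open>cmt G b a\<close> commutes with both factors, so the class-two
  formula applies. Since p is odd, p divides p(p-1)/2, and the last factor disappears.\<close>

lemma mult_pow_cong:
  assumes ab: "a \<in> carrier G" "b \<in> carrier G" and p: "odd (p :: nat)"
    and s: "cmt G (cmt G b a) a \<in> H" "cmt G (cmt G b a) b \<in> H" "cmt G b a [^] p \<in> H"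
  obtains n where "n \<in> H" "(a \<otimes> b) [^] p = a [^] p \<otimes> b [^] p \<otimes> n"
proof -
  let ?Q = "G Mod H" and ?s = "cmt G b a"
  have [simp]: "?s \<in> carrier G" using ab by simp
  have [simp]: "H #> ?s [^] p = H" using s(3) by (simp add: coset_eq_self_iff)
  have "(p * (p - 1) div 2) = p * ((p - 1) div 2)" using p by (auto elim!: oddE)
  then have sp: "(H #> ?s) [^]\<^bsub>?Q\<^esub> (p * (p - 1) div 2) = \<one>\<^bsub>?Q\<^esub>"
    using quot.H.nat_pow_one by (simp flip: quot.H.nat_pow_pow quot.hom_nat_pow)
  have "H #> (b \<otimes> a) = H #> (a \<otimes> b \<otimes> ?s)" using ab by (simp add: word_simps)
  then have "(H #> b) \<otimes>\<^bsub>?Q\<^esub> (H #> a) = (H #> a) \<otimes>\<^bsub>?Q\<^esub> (H #> b) \<otimes>\<^bsub>?Q\<^esub> (H #> ?s)"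
    using ab by (simp del: mult_FactGroup)
  then have "((H #> a) \<otimes>\<^bsub>?Q\<^esub> (H #> b)) [^]\<^bsub>?Q\<^esub> p = (H #> a) [^]\<^bsub>?Q\<^esub> p \<otimes>\<^bsub>?Q\<^esub> (H #> b) [^]\<^bsub>?Q\<^esub> p
      \<otimes>\<^bsub>?Q\<^esub> (H #> ?s) [^]\<^bsub>?Q\<^esub> (p * (p - 1) div 2)"
    using ab s(1,2) by (intro quot.H.class2_pow)
      (auto simp: coset_commute_iff simp del: mult_FactGroup carrier_FactGroup)
  also note sp
  finally have "H #> ((a \<otimes> b) [^] p) = H #> (a [^] p \<otimes> b [^] p)"
    using ab by (simp del: mult_FactGroup one_FactGroup add: quot.hom_nat_pow)
  then show ?thesis using ab that by (elim coset_eqE) auto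
qed

lemma cmt_swap_mem: "x \<in> carrier G \<Longrightarrow> y \<in> carrier G \<Longrightarrow> cmt G x y \<in> H \<longleftrightarrow> cmt G y x \<in> H"
  by (auto simp: coset_commute_iff simp del: mult_FactGroup)

lemma cmt_mem:
  assumes "x \<in> H" "g \<in> carrier G"
  shows "cmt G x g \<in> H" "cmt G g x \<in> H"
proof -
  have x: "x \<in> carrier G" using assms by simp
  have "cmt G x g = inv x \<otimes> (inv g \<otimes> x \<otimes> g)" using assms x by (simp add: word_simps)
  then show "cmt G x g \<in> H" using assms inv_op_closed1 by simp
  then show "cmt G g x \<in> H" using assms x by (simp add: cmt_swap_mem)
qed

text \<open>This is the preimage of the centralizer of the image of \<open>Y\<close> in the
  quotient. Closure under products rests on [ab,y] = [a,y]^b [b,y] and the normality of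
  \<open>H\<close>.\<close>

lemma subgroup_cmt_mem:
  assumes "Y \<subseteq> carrier G"
  shows "subgroup {x \<in> carrier G. \<forall>y\<in>Y. cmt G x y \<in> H} G"
proof (rule subgroupI)
  fix a b assume "a \<in> {x \<in> carrier G. \<forall>y\<in>Y. cmt G x y \<in> H}" "b \<in> {x \<in> carrier G. \<forall>y\<in>Y. cmt G x y \<in> H}"
  then have ab: "a \<in> carrier G" "b \<in> carrier G"
    and c: "\<And>y. y \<in> Y \<Longrightarrow> cmt G a y \<in> H" "\<And>y. y \<in> Y \<Longrightarrow> cmt G b y \<in> H" by auto
  have "cmt G (a \<otimes> b) y \<in> H" if "y \<in> Y" for y
  proof -
    have y: "y \<in> carrier G" using that assms by auto
    have "cmt G (a \<otimes> b) y = (inv b \<otimes> cmt G a y \<otimes> b) \<otimes> cmt G b y"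
      using ab y by (simp add: word_simps)
    then show ?thesis using c that ab inv_op_closed1 by simp
  qed
  then show "a \<otimes> b \<in> {x \<in> carrier G. \<forall>y\<in>Y. cmt G x y \<in> H}" using ab by simp
next
  fix a assume "a \<in> {x \<in> carrier G. \<forall>y\<in>Y. cmt G x y \<in> H}"
  then have a: "a \<in> carrier G" and c: "\<And>y. y \<in> Y \<Longrightarrow> cmt G a y \<in> H" by auto
  have "cmt G (inv a) y \<in> H" if "y \<in> Y" for y
  proof -
    have y: "y \<in> carrier G" using that assms by auto
    have "cmt G (inv a) y = a \<otimes> inv (cmt G a y) \<otimes> inv a"
      using a y by (simp add: word_simps)
    then show ?thesis using c that a inv_op_closed2 by simp
  qed
  then show "inv a \<in> {x \<in> carrier G. \<forall>y\<in>Y. cmt G x y \<in> H}" using a by simp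
qed (use assms cmt_mem(1)[of \<one>] in auto)

text \<open>The centralizer argument is applied once in each variable, using
  \<open>cmt_swap_mem\<close> to exchange the two.\<close>

lemma cmt_generate_mem:
  assumes "A \<subseteq> carrier G" "B \<subseteq> carrier G" "\<And>a b. a \<in> A \<Longrightarrow> b \<in> B \<Longrightarrow> cmt G a b \<in> H"
    and "x \<in> generate G A" "y \<in> generate G B"
  shows "cmt G x y \<in> H"
proof -
  have gA: "generate G A \<subseteq> carrier G" and gB: "generate G B \<subseteq> carrier G"
    using assms generate_incl by auto
  have 1: "generate G A \<subseteq> {x \<in> carrier G. \<forall>y\<in>B. cmt G x y \<in> H}"
    using assms by (intro generate_subgroup_incl subgroup_cmt_mem) auto
  have 2: "generate G B \<subseteq> {y \<in> carrier G. \<forall>x\<in>generate G A. cmt G y x \<in> H}"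
    by (rule generate_subgroup_incl[OF _ subgroup_cmt_mem[OF gA]])
      (use assms(2) 1 in \<open>blast intro: iffD1[OF cmt_swap_mem]\<close>)
  show ?thesis using 2 assms gA gB cmt_swap_mem by blast
qed

text \<open>The layer consists of the elements of \<open>S\<close> that become central and killed by
  \<open>p\<close> modulo \<open>H\<close>. Central elements commute, so p-th powers are
  multiplicative on them; conjugation changes an element only by a factor in
  \<open>H\<close>.\<close>

lemma normal_central_layer:
  assumes S: "S \<lhd> G"
  shows "{s \<in> S. (\<forall>g\<in>carrier G. cmt G s g \<in> H) \<and> s [^] (p::nat) \<in> H} \<lhd> G" (is "?W \<lhd> G")
proof -
  interpret S: normal S G by fact
  have mem: "\<And>s. s \<in> S \<Longrightarrow> s \<in> carrier G" by simp
  have C: "subgroup {s \<in> carrier G. \<forall>g\<in>carrier G. cmt G s g \<in> H} G"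
    using subgroup_cmt_mem by blast
  show ?thesis
  proof (rule normalI_conj[OF subgroupI])
    fix a b assume a: "a \<in> ?W" and b: "b \<in> ?W"
    then have ab: "a \<in> carrier G" "b \<in> carrier G" by auto
    have "(H #> a) \<otimes>\<^bsub>G Mod H\<^esub> (H #> b) = (H #> b) \<otimes>\<^bsub>G Mod H\<^esub> (H #> a)"
      using a ab by (auto simp: coset_commute_iff[symmetric] simp del: mult_FactGroup)
    then have "((H #> a) \<otimes>\<^bsub>G Mod H\<^esub> (H #> b)) [^]\<^bsub>G Mod H\<^esub> p
        = (H #> a) [^]\<^bsub>G Mod H\<^esub> p \<otimes>\<^bsub>G Mod H\<^esub> (H #> b) [^]\<^bsub>G Mod H\<^esub> p"
      using ab by (intro quot.H.commuting_pow) (auto simp del: mult_FactGroup carrier_FactGroup)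
    then have "H #> ((a \<otimes> b) [^] p) = H #> (a [^] p \<otimes> b [^] p)"
      using ab by (simp del: mult_FactGroup one_FactGroup add: quot.hom_nat_pow)
    moreover have "H #> (a [^] p \<otimes> b [^] p) = H"
      using a b ab by (intro iffD2[OF coset_eq_self_iff]) auto
    ultimately have "(a \<otimes> b) [^] p \<in> H" using ab by (intro iffD1[OF coset_eq_self_iff]) auto
    then show "a \<otimes> b \<in> ?W" using a b subgroup.m_closed[OF C, of a b] ab by auto
  next
    fix a assume "a \<in> ?W"
    then show "inv a \<in> ?W"
      using subgroup.m_inv_closed[OF C, of a] mem by (auto simp: nat_pow_inv)
  next
    fix a g assume a: "a \<in> ?W" and g: "g \<in> carrier G"
    then have ac: "a \<in> carrier G" by auto
    let ?c = "inv g \<otimes> a \<otimes> g"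
    have "?c = a \<otimes> cmt G a g" using ac g by (simp add: conj_eq_mult_cmt)
    moreover have "cmt G a g \<in> {s \<in> carrier G. \<forall>g\<in>carrier G. cmt G s g \<in> H}"
      using a g ac cmt_mem(1) by auto
    ultimately have "?c \<in> {s \<in> carrier G. \<forall>g\<in>carrier G. cmt G s g \<in> H}"
      using subgroup.m_closed[OF C] a ac by auto
    then show "?c \<in> ?W" using a g ac S.inv_op_closed1 inv_op_closed1 by (auto simp: conj_pow)
  next
    have "\<one> \<in> ?W" using cmt_mem(1)[of \<one>] by auto
    then show "?W \<noteq> {}" by blast
  next
    show "?W \<subseteq> carrier G" using mem by blast
  qed
qed

end

text \<open>Take \<open>T\<close> maximal among the normal subgroups between \<open>N\<close> and
  \<open>S\<close> other than \<open>S\<close>. The image of \<open>S\<close> in G/T is nontrivial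
  and so meets the centre; the elements of \<open>S\<close> that are central of exponent
  \<open>p\<close> modulo \<open>T\<close> form a normal subgroup larger than \<open>T\<close>,
  which must be \<open>S\<close>.\<close>

lemma (in group) normal_descent:
  assumes p: "Factorial_Ring.prime (p::nat)" and fin: "finite (carrier G)" and ord: "order G = p ^ n"
    and N: "N \<lhd> G" and S: "S \<lhd> G" and "N \<subset> S"
  shows "\<exists>T. T \<lhd> G \<and> N \<subseteq> T \<and> T \<subset> S \<and>
    (\<forall>s\<in>S. \<forall>g\<in>carrier G. cmt G s g \<in> T) \<and> (\<forall>s\<in>S. s [^] p \<in> T)"
proof -
  interpret S: normal S G by fact
  have fS: "finite S" using fin S.subset finite_subset by blast
  define F where "F = {T. T \<lhd> G \<and> N \<subseteq> T \<and> T \<subset> S}"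
  have "finite F" unfolding F_def using fS by (auto intro: finite_subset[of _ "Pow S"])
  moreover have "N \<in> F" unfolding F_def using assms by auto
  ultimately have "\<exists>T\<in>F. N \<subseteq> T \<and> (\<forall>U\<in>F. T \<subseteq> U \<longrightarrow> T = U)"
    by (rule finite_has_maximal2)
  then obtain T where TF: "T \<in> F" and max: "\<forall>U\<in>F. T \<subseteq> U \<longrightarrow> T = U"
    by (elim bexE conjE)
  then have T: "T \<lhd> G" "N \<subseteq> T" "T \<subset> S" by (auto simp: F_def)
  interpret T: normal T G by fact
  let ?Q = "G Mod T"
  interpret quot: group_hom G ?Q "\<lambda>x. T #> x"
    by (intro group_hom.intro group_hom_axioms.intro is_group T.factorgroup_is_group T.r_coset_hom_Mod)
  define K where "K = (\<lambda>x. T #> x) ` S"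
  have cQ: "carrier ?Q = (\<lambda>x. T #> x) ` carrier G" by (simp add: carrier_FactGroup)
  have "order ?Q dvd p ^ n"
    using ord card_eq_inter_times_cosets[OF subgroup_self fin T.is_subgroup]
    unfolding order_def cQ by (metis dvd_triv_right)
  then obtain m where m: "order ?Q = p ^ m" using p by (metis divides_primepow_nat)
  have K: "K \<lhd> ?Q" unfolding K_def
    by (rule S.surj_hom_normal_subgroup[OF quot.group_hom_axioms]) (simp add: cQ)
  have "K \<noteq> {\<one>\<^bsub>?Q\<^esub>}"
  proof
    assume eq: "K = {\<one>\<^bsub>?Q\<^esub>}"
    have "s \<in> T" if "s \<in> S" for s
      using that eq unfolding K_def by (intro iffD1[OF T.coset_eq_self_iff]) auto
    then show False using T by auto
  qed
  then obtain k where k: "k \<in> K" "k \<noteq> \<one>\<^bsub>?Q\<^esub>" "\<And>g. g \<in> carrier ?Q \<Longrightarrow> k \<otimes>\<^bsub>?Q\<^esub> g = g \<otimes>\<^bsub>?Q\<^esub> k"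
    using quot.H.normal_meets_center[OF p _ m K] fin cQ by (metis finite_imageI)
  obtain s where s: "s \<in> S" "k = T #> s" using k(1) unfolding K_def by auto
  have sc: "s \<in> carrier G" using s by simp
  have ks: "cmt G s g \<in> T" if "g \<in> carrier G" for g
    using k(3)[of "T #> g"] that sc s by (simp add: T.coset_commute_iff cQ del: mult_FactGroup)
  have sT: "s \<notin> T" using k(2) s sc T.coset_eq_self_iff by auto
  have ex: "s [^] (p ^ n) \<in> T" using sc fin ord pow_order_eq_1[of s] by simp
  \<comment> \<open>The last power of \<open>s\<close> outside \<open>T\<close> has order exactly
    \<open>p\<close> modulo \<open>T\<close> and is still central there.\<close>
  define j where "j = (LEAST j. s [^] (p ^ j) \<in> T)"
  have j: "s [^] (p ^ j) \<in> T" unfolding j_def using ex by (rule LeastI)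
  then have "j \<noteq> 0" using sT sc by (cases j) auto
  then obtain i where i: "j = Suc i" by (cases j) auto
  define t where "t = s [^] (p ^ i)"
  have tT: "t \<notin> T" using not_less_Least[of i "\<lambda>j. s [^] (p ^ j) \<in> T"] i unfolding j_def t_def by auto
  have C: "subgroup {s \<in> carrier G. \<forall>g\<in>carrier G. cmt G s g \<in> T} G"
    using T.subgroup_cmt_mem by blast
  have pw: "x [^] l \<in> A" if "subgroup A G" "x \<in> A" for x A and l :: nat
    using that by (induction l) (auto simp: subgroup.one_closed subgroup.m_closed)
  have tS: "t \<in> S" unfolding t_def using pw[OF S.is_subgroup s(1)] .
  have tC: "t \<in> {s \<in> carrier G. \<forall>g\<in>carrier G. cmt G s g \<in> T}"
    unfolding t_def by (rule pw[OF C]) (use sc ks in auto)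
  have "t [^] p \<in> T" using j sc i unfolding t_def by (simp add: nat_pow_pow mult.commute)
  let ?W = "{s \<in> S. (\<forall>g\<in>carrier G. cmt G s g \<in> T) \<and> s [^] p \<in> T}"
  have W: "?W \<lhd> G" using T.normal_central_layer[OF S] .
  have "T \<subseteq> ?W" using T pw[OF T.is_subgroup] T.cmt_mem(1) by auto
  moreover have "t \<in> ?W" using tS tC \<open>t [^] p \<in> T\<close> by auto
  ultimately have "?W = S" using bspec[OF max, of ?W] W T tT unfolding F_def by blast
  then show ?thesis using T by (intro exI[of _ T]) blast
qed

section \<open>The series of iterated powers\<close>

text \<open>\<open>pser G p Z H\<close> is the series \<open>H, H\<^sup>p Z, (H\<^sup>p Z)\<^sup>p, \<dots>\<close>; the central subgroup \<open>Z\<close>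
  enters only in the first step.\<close>

primrec pser :: "('a, 'b) monoid_scheme \<Rightarrow> nat \<Rightarrow> 'a set \<Rightarrow> 'a set \<Rightarrow> nat \<Rightarrow> 'a set" where
  "pser G p Z H 0 = H"
| "pser G p Z H (Suc n) =
    generate G ({x [^]\<^bsub>G\<^esub> p | x. x \<in> pser G p Z H n} \<union> (if n = 0 then Z else {}))"

context group
begin

lemma pser_subset:
  assumes "subgroup H G" "Z \<subseteq> H"
  shows "pser G p Z H n \<subseteq> H"
proof (induction n)
  case (Suc n)
  have "{x [^] p | x. x \<in> pser G p Z H n} \<union> (if n = 0 then Z else {}) \<subseteq> H"
    using assms subgroup_pow_closed[OF assms(1)] Suc by auto
  then show ?case using generate_subgroup_incl[OF _ assms(1)] by simp
qed simp

lemma pser_subgroup: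
  assumes "subgroup H G" "Z \<subseteq> H"
  shows "subgroup (pser G p Z H n) G"
proof (cases n)
  case (Suc m)
  have "pser G p Z H m \<subseteq> carrier G" using pser_subset[OF assms] subgroup.subset[OF assms(1)] by blast
  moreover have "Z \<subseteq> carrier G" using assms subgroup.subset by blast
  ultimately show ?thesis unfolding Suc by (auto intro!: generate_is_subgroup)
qed (use assms in simp)

text \<open>Lets the commutator condition for a subgroup be checked with the operations of the
  ambient group.\<close>

lemma pser_consistent:
  assumes "subgroup H G" "Z \<subseteq> H"
  shows "pser (G\<lparr>carrier := H\<rparr>) p Z H n = pser G p Z H n"
proof (induction n)
  case (Suc n)
  have "{x [^] p | x. x \<in> pser G p Z H n} \<union> (if n = 0 then Z else {}) \<subseteq> H"
    using assms subgroup_pow_closed[OF assms(1)] subsetD[OF pser_subset[OF assms]] by auto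
  then show ?case using generate_consistent[OF _ assms(1)]
    by (simp add: Suc flip: nat_pow_consistent)
qed simp

end

text \<open>\<open>Z\<close> is some central subgroup, not necessarily the whole centre: passing to
  a subgroup may enlarge the centre, whereas the induction keeps \<open>Z\<close> fixed, and for
  later terms of the series it is replaced by the trivial subgroup.\<close>

locale p_group_central = group G for G :: "('a, 'b) monoid_scheme" (structure) +
  fixes p :: nat and Z :: "'a set"
  assumes prime: "Factorial_Ring.prime p" and odd: "odd p"
    and fin: "finite (carrier G)" and ord: "\<exists>n. order G = p ^ n"
    and Z_subgroup: "subgroup Z G"
    and Z_central: "z \<in> Z \<Longrightarrow> g \<in> carrier G \<Longrightarrow> z \<otimes> g = g \<otimes> z"
begin

abbreviation P :: "nat \<Rightarrow> 'a set" where "P \<equiv> pser G p Z (carrier G)"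

lemma Z_subset: "Z \<subseteq> carrier G" using Z_subgroup subgroup.subset by blast

lemma P_subgroup: "subgroup (P n) G"
  using pser_subgroup[OF subgroup_self Z_subset] .

lemma P_subset: "P n \<subseteq> carrier G" using P_subgroup subgroup.subset by blast

lemma P_carrier: "x \<in> P n \<Longrightarrow> x \<in> carrier G" using P_subset by blast

lemma P_gens_subset: "{x [^] p | x. x \<in> P n} \<union> (if n = 0 then Z else {}) \<subseteq> carrier G"
  using P_subset Z_subset by auto

text \<open>Conjugation permutes the powers of elements of \<open>K\<close> and fixes the central
  set \<open>Y\<close> pointwise.\<close>

lemma normal_pow_generate:
  assumes K: "K \<lhd> G" and Y: "Y \<subseteq> Z"
  shows "generate G ({x [^] (m :: nat) | x. x \<in> K} \<union> Y) \<lhd> G"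
proof (rule normal_generateI)
  interpret K: normal K G by fact
  show "{x [^] m | x. x \<in> K} \<union> Y \<subseteq> carrier G" using Y Z_subset by auto
  fix h g assume h: "h \<in> {x [^] m | x. x \<in> K} \<union> Y" and g: "g \<in> carrier G"
  show "g \<otimes> h \<otimes> inv g \<in> {x [^] m | x. x \<in> K} \<union> Y"
  proof (cases "h \<in> Y")
    case True
    then have "g \<otimes> h = h \<otimes> g" "h \<in> carrier G" using g Z_central[of h g] Y Z_subset by auto
    then show ?thesis using True g by (simp add: m_assoc)
  next
    case False
    then obtain x where x: "x \<in> K" "h = x [^] m" using h by auto
    have "g \<otimes> h \<otimes> inv g = (g \<otimes> x \<otimes> inv g) [^] m"
      using conj_pow[of x "inv g" m] x g by simp
    then show ?thesis using K.inv_op_closed2[OF g x(1)] by blast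
  qed
qed

lemma P_normal: "P n \<lhd> G"
proof (induction n)
  case 0
  show ?case by (simp add: normal_inv_iff subgroup_self)
next
  case (Suc n)
  then show ?case using normal_pow_generate[of "P n" "if n = 0 then Z else {}" p] by simp
qed

lemma P_pow: "x \<in> P n \<Longrightarrow> x [^] p \<in> P (Suc n)"
  by (auto intro!: generate.incl)

lemma P_Suc_subset: "P (Suc n) \<subseteq> P n"
proof -
  have "Z \<subseteq> P n" if "n = 0" using that Z_subset by simp
  then have "{x [^] p | x. x \<in> P n} \<union> (if n = 0 then Z else {}) \<subseteq> P n"
    using subgroup_pow_closed[OF P_subgroup, of _ n] by auto
  then show ?thesis using generate_subgroup_incl[OF _ P_subgroup] by simp
qed

lemma P_antimono: "m \<le> n \<Longrightarrow> P n \<subseteq> P m"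
  using lift_Suc_antimono_le[of P, OF P_Suc_subset] .

lemma P_pow_pow: "x \<in> P n \<Longrightarrow> x [^] (p ^ k) \<in> P (n + k)"
proof (induction k)
  case (Suc k)
  then show ?case using P_pow[of "x [^] (p ^ k)" "n + k"] P_carrier[of x n]
    by (simp add: nat_pow_pow mult.commute del: pser.simps)
qed (use P_carrier in simp)

lemma Z_subset_P1: "Z \<subseteq> P 1" by (auto intro!: generate.incl)

lemma Z_cmt: "z \<in> Z \<Longrightarrow> g \<in> carrier G \<Longrightarrow> cmt G z g = \<one>"
  using Z_central Z_subset by (subst cmt_eq_one_iff) auto

text \<open>Since \<open>x\<^sup>g = x[x,g]\<close>, conjugation by \<open>g\<close> sends \<open>x\<^sup>p\<close> to \<open>(x[x,g])\<^sup>p\<close>.\<close>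

lemma cmt_pow_mem:
  assumes T: "T \<lhd> G" and x: "x \<in> carrier G" and g: "g \<in> carrier G"
    and c: "cmt G x g [^] p \<in> T"
    and s: "cmt G (cmt G (cmt G x g) x) x \<in> T"
      "cmt G (cmt G (cmt G x g) x) (cmt G x g) \<in> T" "cmt G (cmt G x g) x [^] p \<in> T"
  shows "cmt G (x [^] p) g \<in> T"
proof -
  interpret T: normal T G by fact
  let ?c = "cmt G x g"
  obtain n where n: "n \<in> T" "(x \<otimes> ?c) [^] p = x [^] p \<otimes> ?c [^] p \<otimes> n"
    using T.mult_pow_cong[of x ?c p] x g s odd by auto
  have "cmt G (x [^] p) g = inv (x [^] p) \<otimes> (inv g \<otimes> x [^] p \<otimes> g)"
    using x g by (simp add: word_simps)
  also have "inv g \<otimes> x [^] p \<otimes> g = (x \<otimes> ?c) [^] p"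
    using x g conj_pow[of x g p] by (simp add: conj_eq_mult_cmt)
  finally have "cmt G (x [^] p) g = ?c [^] p \<otimes> n" using n x g T.mem_carrier by (simp add: m_assoc)
  then show ?thesis using c n by simp
qed

text \<open>Take a minimal normal \<open>S\<close> between M^p and \<open>M\<close> containing
  [M,G]. If \<open>S\<close> were larger than M^p, \<open>normal_descent\<close> would give a
  smaller \<open>T\<close> below it, and checking generators of \<open>M\<close> shows that
  \<open>T\<close> contains [M,G] too.\<close>

lemma pow_generate_cmt:
  assumes K: "K \<lhd> G" and Y: "Y \<subseteq> Z" and M: "M = generate G ({x [^] p | x. x \<in> K} \<union> Y)"
    and KM: "\<And>k g. k \<in> K \<Longrightarrow> g \<in> carrier G \<Longrightarrow> cmt G k g \<in> M"
    and m: "m \<in> M" and g: "g \<in> carrier G"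
  shows "cmt G m g \<in> generate G {x [^] p | x. x \<in> M}"
proof -
  interpret K: normal K G by fact
  have Mn: "M \<lhd> G" unfolding M using normal_pow_generate[OF K Y] .
  interpret M: normal M G by fact
  let ?N = "generate G {x [^] p | x. x \<in> M}"
  have N: "?N \<lhd> G" using normal_pow_generate[OF Mn, of "{}" p] by simp
  obtain e where e: "order G = p ^ e" using ord by (elim exE)
  define F where "F = {S. S \<lhd> G \<and> ?N \<subseteq> S \<and> S \<subseteq> M \<and> (\<forall>m\<in>M. \<forall>g\<in>carrier G. cmt G m g \<in> S)}"
  have "?N \<subseteq> M"
    using subgroup_pow_closed[OF M.is_subgroup] by (intro generate_subgroup_incl M.is_subgroup) auto
  then have "M \<in> F" unfolding F_def using Mn M.cmt_mem by auto
  moreover have "finite F" unfolding F_def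
    using finite_subset[OF M.subset fin] by (auto intro: finite_subset[of _ "Pow M"])
  ultimately have "\<exists>S\<in>F. S \<subseteq> M \<and> (\<forall>T\<in>F. T \<subseteq> S \<longrightarrow> S = T)"
    by (intro finite_has_minimal2)
  then obtain S where SF: "S \<in> F" and min: "\<forall>T\<in>F. T \<subseteq> S \<longrightarrow> S = T"
    by (elim bexE conjE)
  then have S: "S \<lhd> G" "?N \<subseteq> S" "S \<subseteq> M" "\<forall>m\<in>M. \<forall>g\<in>carrier G. cmt G m g \<in> S"
    by (auto simp: F_def)
  have "?N = S"
  proof (rule ccontr)
    assume "?N \<noteq> S"
    with S(2) have NS: "?N \<subset> S" by blast
    obtain T where T: "T \<lhd> G" "?N \<subseteq> T" "T \<subset> S"
      "\<forall>s\<in>S. \<forall>g\<in>carrier G. cmt G s g \<in> T"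
      using normal_descent[OF prime fin e N S(1) NS] by (elim exE conjE)
    interpret T: normal T G by (rule T(1))
    have MT: "x [^] p \<in> T" if "x \<in> M" for x
      using that by (intro subsetD[OF T(2)] generate.incl) auto
    have "cmt G x g \<in> T" if x: "x \<in> {x [^] p | x. x \<in> K} \<union> Y" and g: "g \<in> carrier G" for x g
    proof (cases "x \<in> Y")
      case True
      then have "cmt G x g = \<one>" using Y Z_subset g Z_central by (subst cmt_eq_one_iff) auto
      then show ?thesis by simp
    next
      case False
      then obtain k where k: "k \<in> K" "x = k [^] p" using x by auto
      have kc: "k \<in> carrier G" using k by simp
      \<comment> \<open>The commutator [k,g] lies in \<open>M\<close>, so [[k,g],k] lies in
        \<open>S\<close> by the choice of \<open>S\<close>, and one further commutator falls into
        \<open>T\<close>. The p-th powers of elements of \<open>M\<close> are in \<open>T\<close>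
        anyway, so \<open>cmt_pow_mem\<close> applies.\<close>
      have c: "cmt G k g \<in> M" using KM k g by simp
      then have s: "cmt G (cmt G k g) k \<in> S" using S kc by auto
      then have "cmt G (cmt G k g) k \<in> M" using S by auto
      then show ?thesis unfolding k(2) using c s g kc MT T(4)
        by (intro cmt_pow_mem T(1)) auto
    qed
    note gens = this
    have "\<forall>m\<in>M. \<forall>g\<in>carrier G. cmt G m g \<in> T"
    proof (intro ballI)
      fix m g assume m: "m \<in> M" and g: "g \<in> carrier G"
      show "cmt G m g \<in> T"
      proof (rule T.cmt_generate_mem)
        show "m \<in> generate G ({x [^] p | x. x \<in> K} \<union> Y)" using m unfolding M .
        show "g \<in> generate G (carrier G)" using g by (rule generate.incl)
        show "{x [^] p | x. x \<in> K} \<union> Y \<subseteq> carrier G" using Y Z_subset by auto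
      qed (use gens in auto)
    qed
    then have "T \<in> F" unfolding F_def using T(1-3) S(3) by blast
    then show False using min T(3) by blast
  qed
  then show ?thesis using S m g by auto
qed

end

text \<open>The theorem concerns \<open>d = 0\<close>; the first term of the series satisfies the condition with \<open>d = 1\<close>.\<close>

locale quasi_pow = p_group_central +
  fixes d :: nat
  assumes cmt_P: "x \<in> carrier G \<Longrightarrow> y \<in> carrier G \<Longrightarrow> cmt G x y \<in> P (Suc d)"
begin

text \<open>The hypothesis on the group gives \<open>n = 0\<close>. Later steps are the descent
  argument just made, with \<open>Z\<close> adjoined only for \<open>n = 0\<close>, as in
  \<open>pser\<close>.\<close>

lemma P_cmt1: "x \<in> P n \<Longrightarrow> g \<in> carrier G \<Longrightarrow> cmt G x g \<in> P (Suc n)"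
proof (induction n arbitrary: x g)
  case 0
  then show ?case using cmt_P P_antimono[of "Suc 0" "Suc d"] by (auto simp del: pser.simps(2))
next
  case (Suc n)
  have "cmt G x g \<in> generate G {x [^] p | x. x \<in> P (Suc n)}"
    by (rule pow_generate_cmt[OF P_normal[of n], where Y = "if n = 0 then Z else {}"])
      (use Suc in auto)
  then show ?case by simp
qed

lemma P_cmt_pow:
  assumes "x \<in> carrier G" "g \<in> carrier G" "cmt G x g \<in> P k"
  shows "cmt G (x [^] p) g \<in> P (Suc k)"
proof (rule cmt_pow_mem[OF P_normal])
  interpret T: normal "P (Suc k)" G by (rule P_normal)
  have s: "cmt G (cmt G x g) x \<in> P (Suc k)" using P_cmt1 assms by blast
  then show "cmt G (cmt G (cmt G x g) x) x \<in> P (Suc k)"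
    "cmt G (cmt G (cmt G x g) x) (cmt G x g) \<in> P (Suc k)"
    using assms T.cmt_mem by (auto simp del: pser.simps)
  show "cmt G x g [^] p \<in> P (Suc k)" using P_pow assms by blast
  show "cmt G (cmt G x g) x [^] p \<in> P (Suc k)" using s subgroup_pow_closed[OF P_subgroup] by blast
qed (use assms in auto)

lemma P_Suc_cmt:
  assumes g: "g \<in> carrier G" and *: "\<And>x. x \<in> P n \<Longrightarrow> cmt G x g \<in> P k" and x: "x \<in> P (Suc n)"
  shows "cmt G x g \<in> P (Suc k)"
proof -
  interpret T: normal "P (Suc k)" G by (rule P_normal)
  show ?thesis
  proof (rule T.cmt_generate_mem[where B = "{g}"])
    show "x \<in> generate G ({x [^] p | x. x \<in> P n} \<union> (if n = 0 then Z else {}))" using x by simp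
    fix a b assume a: "a \<in> {x [^] p | x. x \<in> P n} \<union> (if n = 0 then Z else {})" and "b \<in> {g}"
    then have "b = g" by simp
    show "cmt G a b \<in> P (Suc k)"
    proof (cases "a \<in> Z")
      case True
      then show ?thesis using Z_cmt[of a g] g \<open>b = g\<close> by (simp del: pser.simps)
    next
      case False
      then obtain y where "y \<in> P n" "a = y [^] p" using a by (auto split: if_splits simp del: pser.simps)
      then show ?thesis using P_cmt_pow[of y g k] * g P_carrier \<open>b = g\<close> by (simp del: pser.simps)
    qed
  qed (use g P_gens_subset in \<open>auto intro: generate.incl\<close>)
qed

text \<open>Starting from [G,G] in \<open>P (Suc d)\<close>, each step down the series in either
  argument gains one term by \<open>P_Suc_cmt\<close>; the second argument is reached by
  swapping.\<close>

lemma P_cmt: "x \<in> P m \<Longrightarrow> y \<in> P n \<Longrightarrow> cmt G x y \<in> P (m + n + Suc d)"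
proof (induction n arbitrary: m x y)
  case 0
  then show ?case
  proof (induction m arbitrary: x)
    case (Suc m)
    then show ?case using P_Suc_cmt[of y m "m + 0 + Suc d" x] P_carrier by (simp del: pser.simps(2))
  qed (use cmt_P in \<open>simp del: pser.simps(2)\<close>)
next
  case (Suc n)
  have x: "x \<in> carrier G" and y: "y \<in> carrier G" using Suc P_carrier by blast+
  interpret T: normal "P k" G for k by (rule P_normal)
  have "cmt G z x \<in> P (m + n + Suc d)" if "z \<in> P n" for z
    using Suc.IH[OF Suc.prems(1) that] P_carrier[OF that] x T.cmt_swap_mem by blast
  then have "cmt G y x \<in> P (Suc (m + n + Suc d))" using P_Suc_cmt[of x n _ y] x Suc.prems by blast
  then have "cmt G x y \<in> P (Suc (m + n + Suc d))" using T.cmt_swap_mem x y by blast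
  then show ?case by (simp del: pser.simps)
qed

end

declare pser.simps(2) [simp del]

section \<open>Subgroups inheriting the hypothesis, and powers modulo the series\<close>

context quasi_pow
begin

lemma quasi_pow_subgroup:
  assumes H: "subgroup H G" and Y: "subgroup Y G" "Y \<subseteq> H" "Y \<subseteq> Z"
    and c: "\<And>x y. x \<in> H \<Longrightarrow> y \<in> H \<Longrightarrow> cmt G x y \<in> pser G p Y H (Suc e)"
  shows "quasi_pow (G\<lparr>carrier := H\<rparr>) p Y e"
proof -
  interpret H: subgroup H G by fact
  have "card H dvd order G"
    using card_eq_inter_times_cosets[OF subgroup_self fin H] H.subset
    by (simp add: order_def Int_absorb1)
  then have "\<exists>n. order (G\<lparr>carrier := H\<rparr>) = p ^ n"
    using ord divides_primepow_nat[OF prime] by (auto simp: order_def)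
  moreover have "subgroup Y (G\<lparr>carrier := H\<rparr>)" using subgroup_incl Y H by blast
  moreover have "z \<otimes> g = g \<otimes> z" if "z \<in> Y" "g \<in> H" for z g
    using that Y(3) by (intro Z_central) auto
  ultimately show ?thesis
    using H.subgroup_is_group[OF is_group] finite_subset[OF H.subset fin]
      prime odd pser_consistent[OF H Y(2)] cmt_consistent[OF H] c
    by (intro quasi_pow.intro p_group_central.intro p_group_central_axioms.intro quasi_pow_axioms.intro)
      auto
qed

text \<open>A subgroup containing M lags at most one term behind \<open>G\<close>. Gaining one extra
  term in \<open>G\<close> is therefore enough to verify the hypothesis inside it.\<close>

lemma P_Suc_subset_pser:
  assumes "P (Suc 0) \<subseteq> H"
  shows "P (Suc n) \<subseteq> pser G p Z H n"
proof (induction n)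
  case (Suc n)
  then have "{x [^] p | x. x \<in> P (Suc n)} \<subseteq> {x [^] p | x. x \<in> pser G p Z H n}" by blast
  then show ?case unfolding pser.simps(2)[of G p Z _ "Suc n"] pser.simps(2)[of G p Z H n]
    by (intro mono_generate) (simp add: le_supI1)
qed (use assms in simp)

text \<open>The subgroup <u>M, where M = \<open>P (Suc 0)\<close>.\<close>

definition L :: "'a \<Rightarrow> 'a set" where "L u = generate G (insert u (P (Suc 0)))"

lemma L_subgroup: "u \<in> carrier G \<Longrightarrow> subgroup (L u) G"
  unfolding L_def using P_subset by (intro generate_is_subgroup) auto

lemma L_self: "u \<in> L u" unfolding L_def by (intro generate.incl) auto

lemma P1_subset_L: "P (Suc 0) \<subseteq> L u" unfolding L_def by (auto intro: generate.incl)

lemma Z_subset_L: "Z \<subseteq> L u" using Z_subset_P1 P1_subset_L by auto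

lemma P_cmt_le: "x \<in> P m \<Longrightarrow> y \<in> P n \<Longrightarrow> k \<le> m + n + Suc d \<Longrightarrow> cmt G x y \<in> P k"
  using P_cmt P_antimono by blast

text \<open>If M is central modulo \<open>P k\<close>, then <u>M is generated modulo
  \<open>P k\<close> by one element and central ones, hence is abelian there.\<close>

lemma cmt_L_mem:
  assumes "u \<in> carrier G" "x \<in> L u" "y \<in> L u"
    and *: "\<And>m g. m \<in> P (Suc 0) \<Longrightarrow> g \<in> carrier G \<Longrightarrow> cmt G m g \<in> P k"
  shows "cmt G x y \<in> P k"
proof -
  interpret T: normal "P k" G by (rule P_normal)
  show ?thesis
  proof (rule T.cmt_generate_mem)
    show "x \<in> generate G (insert u (P (Suc 0)))" "y \<in> generate G (insert u (P (Suc 0)))"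
      using assms(2,3) by (simp_all add: L_def)
    show "insert u (P (Suc 0)) \<subseteq> carrier G" using assms(1) P_subset by auto
    then show "insert u (P (Suc 0)) \<subseteq> carrier G" .
    show "cmt G a b \<in> P k" if ab: "a \<in> insert u (P (Suc 0))" "b \<in> insert u (P (Suc 0))" for a b
    proof (cases "a \<in> P (Suc 0)")
      case True
      then show ?thesis using * ab assms(1) P_carrier by blast
    next
      case False
      then have "a = u" using ab by simp
      then show ?thesis
        using * ab assms(1) P_carrier[of b "Suc 0"] T.cmt_swap_mem[of a b] by auto
    qed
  qed
qed

text \<open>[M,G] lies in \<open>P (Suc (Suc d))\<close>, so <u>M is abelian modulo that term. The
  extra term pays for the shift in \<open>P_Suc_subset_pser\<close>.\<close>

lemma quasi_pow_L:
  assumes u: "u \<in> carrier G"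
  shows "quasi_pow (G\<lparr>carrier := L u\<rparr>) p Z d"
proof (rule quasi_pow_subgroup[OF L_subgroup[OF u] Z_subgroup Z_subset_L subset_refl])
  fix x y assume "x \<in> L u" "y \<in> L u"
  moreover have "cmt G m g \<in> P (Suc (Suc d))" if "m \<in> P (Suc 0)" "g \<in> carrier G" for m g
    using that by (intro P_cmt_le[of m "Suc 0" g 0]) simp_all
  ultimately have "cmt G x y \<in> P (Suc (Suc d))" by (rule cmt_L_mem[OF u])
  then show "cmt G x y \<in> pser G p Z (L u) (Suc d)" using P_Suc_subset_pser[OF P1_subset_L] by blast
qed

text \<open>[M,M] lies in \<open>P 3\<close>, and this is contained in the second term of the series
  of M; hence the parameter 1, whatever \<open>d\<close> was.\<close>

lemma quasi_pow_P1: "quasi_pow (G\<lparr>carrier := P (Suc 0)\<rparr>) p Z 1"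
proof (rule quasi_pow_subgroup[OF P_subgroup Z_subgroup _ subset_refl])
  show "Z \<subseteq> P (Suc 0)" using Z_subset_P1 by simp
  fix x y assume "x \<in> P (Suc 0)" "y \<in> P (Suc 0)"
  then have "cmt G x y \<in> P (Suc (Suc 1))" by (rule P_cmt_le) simp
  then show "cmt G x y \<in> pser G p Z (P (Suc 0)) (Suc 1)" using P_Suc_subset_pser by blast
qed

text \<open>From \<open>P 1\<close> on the next term is generated by p-th powers alone, so these
  terms are powerful and satisfy the hypothesis with trivial central subgroup.\<close>

lemma quasi_pow_P_Suc: "quasi_pow (G\<lparr>carrier := P (Suc n)\<rparr>) p {\<one>} 0"
proof (rule quasi_pow_subgroup[OF P_subgroup])
  show "subgroup {\<one>} G" using one_is_normal normal_imp_subgroup by blast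
  show "{\<one>} \<subseteq> P (Suc n)" using P_subgroup subgroup.one_closed by blast
  show "{\<one>} \<subseteq> Z" using Z_subgroup subgroup.one_closed by blast
  fix x y assume "x \<in> P (Suc n)" "y \<in> P (Suc n)"
  then have "cmt G x y \<in> P (Suc (Suc n))" by (rule P_cmt_le) simp
  also have "\<dots> \<subseteq> pser G p {\<one>} (P (Suc n)) (Suc 0)"
    unfolding pser.simps(2)[of G p Z _ "Suc n"] pser.simps(2)[of G p "{\<one>}" _ 0]
    by (intro mono_generate) auto
  finally show "cmt G x y \<in> pser G p {\<one>} (P (Suc n)) (Suc 0)" .
qed

text \<open>A nontrivial normal subgroup has a proper normal subgroup containing all its p-th
  powers, so the orders decrease strictly. The count starts at \<open>P 1\<close> because adjoining
  \<open>Z\<close> may make \<open>P 1\<close> equal to \<open>P 0\<close>.\<close>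

lemma P_eventually_trivial: "\<exists>n. P (Suc n) = {\<one>}"
proof (rule ccontr)
  assume nt: "\<not> ?thesis"
  obtain e where e: "order G = p ^ e" using ord by (elim exE)
  have less: "card (P (Suc (Suc n))) < card (P (Suc n))" for n
  proof -
    have "{\<one>} \<subset> P (Suc n)" using nt P_subgroup subgroup.one_closed by blast
    from normal_descent[OF prime fin e one_is_normal P_normal this]
    obtain T where T: "T \<lhd> G" "T \<subset> P (Suc n)" "\<forall>s\<in>P (Suc n). s [^] p \<in> T" by (elim exE conjE)
    then have "P (Suc (Suc n)) \<subseteq> T"
      unfolding pser.simps(2)[of G p Z _ "Suc n"]
      by (intro generate_subgroup_incl normal_imp_subgroup) auto
    then show ?thesis using T finite_subset[OF P_subset fin] by (intro psubset_card_mono) auto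
  qed
  have "card (P (Suc n)) + n \<le> card (P (Suc 0))" for n
  proof (induction n)
    case (Suc n)
    then show ?case using less[of n] by linarith
  qed simp
  from this[of "Suc (card (P (Suc 0)))"] show False by simp
qed

text \<open>If [G,G] lies in \<open>P (Suc n)\<close>, then [M,G] lies in the next term, and G =
  <u>M is abelian modulo that term. So [G,G] sinks through the whole series.\<close>

lemma abelian_if_L_eq:
  assumes u: "u \<in> carrier G" and L: "L u = carrier G" and xy: "x \<in> carrier G" "y \<in> carrier G"
  shows "x \<otimes> y = y \<otimes> x"
proof -
  have "\<forall>x\<in>carrier G. \<forall>y\<in>carrier G. cmt G x y \<in> P (Suc n)" for n
  proof (induction n)
    case 0
    then show ?case using P_cmt_le[of _ 0 _ 0 "Suc 0"] by simp
  next
    case (Suc n)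
    have "cmt G m g \<in> P (Suc (Suc n))" if "m \<in> P (Suc 0)" "g \<in> carrier G" for m g
      using that Suc by (intro P_Suc_cmt[of g 0 "Suc n" m]) simp_all
    then show ?case using cmt_L_mem[OF u] L by blast
  qed
  then have "cmt G x y = \<one>" using xy P_eventually_trivial by (metis singletonD)
  then show ?thesis using cmt_eq_one_iff xy by blast
qed

lemma card_L_less:
  assumes "u \<in> carrier G" "L u \<noteq> carrier G"
  shows "card (L u) < card (carrier G)"
  using assms L_subgroup[of u] subgroup.subset fin by (intro psubset_card_mono) blast+

text \<open>Inductively, let a and b be the p^i-th powers of \<open>x\<close> and \<open>y\<close>.
  They lie in \<open>P i\<close>, so [b,a] lies in \<open>P (Suc i)\<close>, while its p-th power
  and its further commutators lie one term lower; the error \<open>n\<close> from the previous stage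
  also drops one term when raised to the power p.\<close>

lemma pow_mult_cong:
  assumes xy: "x \<in> carrier G" "y \<in> carrier G"
  shows "\<exists>n\<in>P (Suc i). (x \<otimes> y) [^] (p ^ i) = x [^] (p ^ i) \<otimes> y [^] (p ^ i) \<otimes> n"
proof (induction i)
  case 0
  have "\<one> \<in> P (Suc 0)" using P_subgroup subgroup.one_closed by blast
  then show ?case using xy by (intro bexI[of _ \<one>]) simp_all
next
  case (Suc i)
  interpret T: normal "P (Suc (Suc i))" G by (rule P_normal)
  let ?a = "x [^] (p ^ i)" and ?b = "y [^] (p ^ i)"
  have ab: "?a \<in> P i" "?b \<in> P i" using P_pow_pow[of _ 0 i] xy by auto
  have abc: "?a \<in> carrier G" "?b \<in> carrier G" using xy by auto
  have abP: "?a \<otimes> ?b \<in> P i" using ab by (rule subgroup.m_closed[OF P_subgroup])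
  obtain n where n: "n \<in> P (Suc i)" "(x \<otimes> y) [^] (p ^ i) = ?a \<otimes> ?b \<otimes> n" using Suc by blast
  have nc: "n \<in> carrier G" using n P_carrier by blast
  have s: "cmt G ?b ?a \<in> P (Suc i)" using ab by (intro P_cmt_le) auto
  have "cmt G (cmt G ?b ?a) g \<in> P (Suc (Suc i))" if "g \<in> carrier G" for g
    using P_cmt1[OF s that] .
  then obtain n1 where n1: "n1 \<in> P (Suc (Suc i))" "(?a \<otimes> ?b) [^] p = ?a [^] p \<otimes> ?b [^] p \<otimes> n1"
    using T.mult_pow_cong[OF abc odd _ _ P_pow[OF s]] abc by blast
  have t: "cmt G n (?a \<otimes> ?b) \<in> P (Suc (Suc i))" using P_cmt1[OF n(1)] abc by blast
  obtain n2 where n2: "n2 \<in> P (Suc (Suc i))"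
    "(?a \<otimes> ?b \<otimes> n) [^] p = (?a \<otimes> ?b) [^] p \<otimes> n [^] p \<otimes> n2"
    using T.mult_pow_cong[of "?a \<otimes> ?b" n p] abc nc odd T.cmt_mem(1)[OF t]
      subgroup_pow_closed[OF T.is_subgroup t] by blast
  have np: "n [^] p \<in> P (Suc (Suc i))" using P_pow n by blast
  have c: "n1 \<in> carrier G" "n2 \<in> carrier G" "n [^] p \<in> carrier G" using n1 n2 np P_carrier by auto
  have "(x \<otimes> y) [^] (p ^ Suc i) = (?a \<otimes> ?b \<otimes> n) [^] p"
    using xy by (simp add: n(2)[symmetric] nat_pow_pow mult.commute)
  also have "\<dots> = ?a [^] p \<otimes> ?b [^] p \<otimes> (n1 \<otimes> n [^] p \<otimes> n2)"
    using n1 n2 abc c by (simp add: m_assoc)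
  also have "\<dots> = x [^] (p ^ Suc i) \<otimes> y [^] (p ^ Suc i) \<otimes> (n1 \<otimes> n [^] p \<otimes> n2)"
    using xy by (simp add: nat_pow_pow mult.commute)
  finally show ?case using n1 n2 np T.m_closed by blast
qed

end

section \<open>Products of powers\<close>

context quasi_pow
begin

text \<open>With u = xy, the product x^p y^p differs from u^p by an element of \<open>P 2\<close>,
  which is generated by p-th powers from M. All of this lies in <u>M, whose p-th powers form a
  subgroup by induction.\<close>

lemma pow_p_mult_step:
  assumes IH: "\<And>u. u \<in> carrier G \<Longrightarrow> L u \<noteq> carrier G \<Longrightarrow>
      \<forall>x\<in>L u. \<forall>y\<in>L u. \<exists>z\<in>L u. x [^] p \<otimes> y [^] p = z [^] p"
    and xy: "x \<in> carrier G" "y \<in> carrier G"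
  shows "\<exists>z\<in>carrier G. x [^] p \<otimes> y [^] p = z [^] p"
proof (cases "L (x \<otimes> y) = carrier G")
  case True
  then have "(x \<otimes> y) [^] p = x [^] p \<otimes> y [^] p"
    using abelian_if_L_eq[of "x \<otimes> y" x y] xy by (intro commuting_pow) auto
  then show ?thesis using xy by (intro bexI[of _ "x \<otimes> y"]) auto
next
  case False
  let ?u = "x \<otimes> y"
  have u: "?u \<in> carrier G" using xy by simp
  interpret L: subgroup "L ?u" G using L_subgroup[OF u] .
  let ?R = "{z [^] p | z. z \<in> L ?u}"
  interpret R: subgroup ?R G
    by (rule pow_set_subgroup[OF L_subgroup[OF u] bspec[OF bspec[OF IH[OF u False]]]])
  obtain n where n: "n \<in> P (Suc 1)" "?u [^] p = x [^] p \<otimes> y [^] p \<otimes> n"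
    using pow_mult_cong[OF xy, of 1] by auto
  have nc: "n \<in> carrier G" using n P_carrier by blast
  have "P (Suc 1) \<subseteq> ?R" unfolding pser.simps(2)[of G p Z _ 1]
    by (rule generate_subgroup_incl[OF _ R.subgroup_axioms]) (use P1_subset_L[of ?u] in auto)
  then have "inv n \<in> ?R" using n R.m_inv_closed by blast
  moreover have "?u [^] p \<in> ?R" using L_self by blast
  ultimately have "?u [^] p \<otimes> inv n \<in> ?R" by (simp only: R.m_closed)
  moreover have "?u [^] p \<otimes> inv n = x [^] p \<otimes> y [^] p" using n nc xy by (simp add: m_assoc)
  ultimately show ?thesis using L.mem_carrier by auto
qed

end

lemma pow_p_mult:
  "quasi_pow G p Z d \<Longrightarrow> \<forall>x\<in>carrier G. \<forall>y\<in>carrier G. \<exists>z\<in>carrier G.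
    x [^]\<^bsub>G\<^esub> p \<otimes>\<^bsub>G\<^esub> y [^]\<^bsub>G\<^esub> p = z [^]\<^bsub>G\<^esub> p"
proof (induction "card (carrier G)" arbitrary: G rule: less_induct)
  case less
  interpret quasi_pow G p Z d by fact
  show ?case
  proof (intro ballI, rule pow_p_mult_step)
    fix u assume u: "u \<in> carrier G" "L u \<noteq> carrier G"
    then have "card (carrier (G\<lparr>carrier := L u\<rparr>)) < card (carrier G)" using card_L_less by simp
    from less.hyps[OF this quasi_pow_L[OF u(1)]]
    show "\<forall>x\<in>L u. \<forall>y\<in>L u. \<exists>z\<in>L u. x [^]\<^bsub>G\<^esub> p \<otimes>\<^bsub>G\<^esub> y [^]\<^bsub>G\<^esub> p = z [^]\<^bsub>G\<^esub> p"
      by (simp flip: nat_pow_consistent)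
  qed
qed

context quasi_pow
begin

text \<open>Closure of p-th powers under products is applied inside \<open>P (Suc n)\<close> itself,
  with trivial central subgroup.\<close>

lemma P_Suc_Suc_eq: "P (Suc (Suc n)) = {x [^] p | x. x \<in> P (Suc n)}"
proof
  have "subgroup {x [^] p | x. x \<in> P (Suc n)} G"
    using pow_p_mult[OF quasi_pow_P_Suc[of n]]
    by (intro pow_set_subgroup P_subgroup) (simp flip: nat_pow_consistent)
  then show "P (Suc (Suc n)) \<subseteq> {x [^] p | x. x \<in> P (Suc n)}"
    unfolding pser.simps(2)[of G p Z _ "Suc n"] by (intro generate_subgroup_incl) auto
  show "{x [^] p | x. x \<in> P (Suc n)} \<subseteq> P (Suc (Suc n))" using P_pow by auto
qed

lemma P_Suc_eq: "P (Suc n) = {x [^] (p ^ n) | x. x \<in> P (Suc 0)}"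
proof (induction n)
  case 0
  show ?case using P_carrier by force
next
  case (Suc n)
  have "P (Suc (Suc n)) = {(x [^] (p ^ n)) [^] p | x. x \<in> P (Suc 0)}"
    unfolding P_Suc_Suc_eq[of n] Suc by blast
  also have "\<dots> = {x [^] (p ^ Suc n) | x. x \<in> P (Suc 0)}"
  proof (rule Collect_cong)
    have "(x [^] (p ^ n)) [^] p = x [^] (p ^ Suc n)" if "x \<in> P (Suc 0)" for x
      using P_carrier[OF that] by (simp add: nat_pow_pow mult.commute)
    then show "(\<exists>x. a = (x [^] (p ^ n)) [^] p \<and> x \<in> P (Suc 0)) \<longleftrightarrow>
        (\<exists>x. a = x [^] (p ^ Suc n) \<and> x \<in> P (Suc 0))" for a by metis
  qed
  finally show ?case .
qed

text \<open>Since p-th powers are closed under products and \<open>Z\<close> is central, the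
  elements e^p z already form a subgroup.\<close>

lemma P_1_elem:
  assumes "c \<in> P (Suc 0)"
  shows "\<exists>e\<in>carrier G. \<exists>z\<in>Z. c = e [^] p \<otimes> z"
proof -
  interpret Z: subgroup Z G by (rule Z_subgroup)
  let ?S = "{e [^] p \<otimes> z | e z. e \<in> carrier G \<and> z \<in> Z}"
  have S: "e [^] p \<otimes> z \<in> ?S" if "e \<in> carrier G" "z \<in> Z" for e z using that by blast
  have "subgroup ?S G"
  proof (rule subgroupI)
    have "e [^] p \<otimes> z \<in> carrier G" if "e \<in> carrier G" "z \<in> Z" for e z using that by simp
    then show "?S \<subseteq> carrier G" by blast
    show "?S \<noteq> {}" using S[of \<one> \<one>] Z.one_closed by auto
    fix a assume "a \<in> ?S"
    then obtain e z where a: "a = e [^] p \<otimes> z" "e \<in> carrier G" "z \<in> Z" by auto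
    then have "inv a = inv e [^] p \<otimes> inv z"
      using Z_central[of "inv z" "inv (e [^] p)"] by (simp add: inv_mult_group nat_pow_inv)
    then show "inv a \<in> ?S" using S[of "inv e" "inv z"] a by simp
    fix b assume "b \<in> ?S"
    then obtain e' z' where b: "b = e' [^] p \<otimes> z'" "e' \<in> carrier G" "z' \<in> Z" by auto
    obtain e'' where e'': "e'' \<in> carrier G" "e [^] p \<otimes> e' [^] p = e'' [^] p"
      using pow_p_mult[OF quasi_pow_axioms] a b by blast
    have "a \<otimes> b = e [^] p \<otimes> (z \<otimes> e' [^] p) \<otimes> z'" using a b by (simp add: m_assoc)
    also have "z \<otimes> e' [^] p = e' [^] p \<otimes> z" by (rule Z_central) (use a b in auto)
    also have "e [^] p \<otimes> (e' [^] p \<otimes> z) \<otimes> z' = e'' [^] p \<otimes> (z \<otimes> z')"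
      unfolding e''(2)[symmetric] using a b by (simp add: m_assoc)
    finally show "a \<otimes> b \<in> ?S" using S[OF e''(1), of "z \<otimes> z'"] a b by simp
  qed
  moreover have "{x [^] p | x. x \<in> P 0} \<union> Z \<subseteq> ?S"
  proof
    fix c assume "c \<in> {x [^] p | x. x \<in> P 0} \<union> Z"
    then consider e where "e \<in> carrier G" "c = e [^] p" | "c \<in> Z" by auto
    then show "c \<in> ?S"
    proof cases
      case 1
      then show ?thesis using S[OF 1(1) Z.one_closed] by simp
    next
      case 2
      then show ?thesis using S[OF one_closed 2] by simp
    qed
  qed
  ultimately have "P (Suc 0) \<subseteq> ?S"
    unfolding pser.simps(2)[of G p Z _ 0] by (simp add: generate_subgroup_incl)
  with assms have "c \<in> ?S" by (rule rev_subsetD)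
  then show ?thesis by blast
qed

lemma P_elem:
  assumes "c \<in> P n"
  shows "\<exists>e\<in>carrier G. \<exists>z\<in>Z. c = e [^] (p ^ n) \<otimes> z"
proof (cases n)
  case 0
  have "\<one> \<in> Z" using Z_subgroup subgroup.one_closed by blast
  then show ?thesis using assms 0 by (intro bexI[of _ c] bexI[of _ \<one>]) auto
next
  case (Suc k)
  then obtain m where m: "m \<in> P (Suc 0)" "c = m [^] (p ^ k)" using assms P_Suc_eq[of k] by auto
  then obtain e z where ez: "e \<in> carrier G" "z \<in> Z" "m = e [^] p \<otimes> z" using P_1_elem by blast
  have zc: "z \<in> carrier G" using ez Z_subset by blast
  have "c = (e [^] p) [^] (p ^ k) \<otimes> z [^] (p ^ k)"
    unfolding m(2) ez(3) using ez zc Z_central[of z "e [^] p"] by (intro commuting_pow) auto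
  then have "c = e [^] (p ^ n) \<otimes> z [^] (p ^ k)" using ez Suc by (simp add: nat_pow_pow)
  then show ?thesis using ez subgroup_pow_closed[OF Z_subgroup ez(2)] by blast
qed

text \<open>The argument used for p-th powers carries over because the error in
  \<open>P (Suc i)\<close> is now known to be a single p^i-th power of an element of M.\<close>

lemma pow_mult_step:
  assumes IH: "\<And>u. u \<in> carrier G \<Longrightarrow> L u \<noteq> carrier G \<Longrightarrow>
      \<forall>x\<in>L u. \<forall>y\<in>L u. \<exists>z\<in>L u. x [^] (p ^ i) \<otimes> y [^] (p ^ i) = z [^] (p ^ i)"
    and xy: "x \<in> carrier G" "y \<in> carrier G"
  shows "\<exists>z\<in>carrier G. x [^] (p ^ i) \<otimes> y [^] (p ^ i) = z [^] (p ^ i)"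
proof (cases "L (x \<otimes> y) = carrier G")
  case True
  then have "(x \<otimes> y) [^] (p ^ i) = x [^] (p ^ i) \<otimes> y [^] (p ^ i)"
    using abelian_if_L_eq[of "x \<otimes> y" x y] xy by (intro commuting_pow) auto
  then show ?thesis using xy by (intro bexI[of _ "x \<otimes> y"]) auto
next
  case False
  let ?u = "x \<otimes> y"
  have u: "?u \<in> carrier G" using xy by simp
  obtain n where n: "n \<in> P (Suc i)" "?u [^] (p ^ i) = x [^] (p ^ i) \<otimes> y [^] (p ^ i) \<otimes> n"
    using pow_mult_cong[OF xy, of i] by auto
  have nc: "n \<in> carrier G" using n P_carrier by blast
  have "inv n \<in> P (Suc i)" using subgroup.m_inv_closed[OF P_subgroup n(1)] .
  then obtain m where m: "m \<in> P (Suc 0)" "inv n = m [^] (p ^ i)" using P_Suc_eq[of i] by auto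
  then have "m \<in> L ?u" using P1_subset_L by blast
  then obtain z where z: "z \<in> L ?u" "?u [^] (p ^ i) \<otimes> inv n = z [^] (p ^ i)"
    unfolding m(2) using IH[OF u False] L_self by blast
  moreover have "?u [^] (p ^ i) \<otimes> inv n = x [^] (p ^ i) \<otimes> y [^] (p ^ i)"
    using n nc xy by (simp add: m_assoc)
  ultimately show ?thesis using subgroup.mem_carrier[OF L_subgroup[OF u]] by auto
qed

end

lemma pow_mult:
  "quasi_pow G p Z d \<Longrightarrow> \<forall>x\<in>carrier G. \<forall>y\<in>carrier G. \<exists>z\<in>carrier G.
    x [^]\<^bsub>G\<^esub> (p ^ i) \<otimes>\<^bsub>G\<^esub> y [^]\<^bsub>G\<^esub> (p ^ i) = z [^]\<^bsub>G\<^esub> (p ^ i)"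
proof (induction "card (carrier G)" arbitrary: G rule: less_induct)
  case less
  interpret quasi_pow G p Z d by fact
  show ?case
  proof (intro ballI, rule pow_mult_step)
    fix u assume u: "u \<in> carrier G" "L u \<noteq> carrier G"
    then have "card (carrier (G\<lparr>carrier := L u\<rparr>)) < card (carrier G)" using card_L_less by simp
    from less.hyps[OF this quasi_pow_L[OF u(1)]]
    show "\<forall>x\<in>L u. \<forall>y\<in>L u. \<exists>z\<in>L u.
        x [^]\<^bsub>G\<^esub> (p ^ i) \<otimes>\<^bsub>G\<^esub> y [^]\<^bsub>G\<^esub> (p ^ i) = z [^]\<^bsub>G\<^esub> (p ^ i)"
      by (simp flip: nat_pow_consistent)
  qed
qed

section \<open>Orders of products\<close>

text \<open>Without a bound on the order of \<open>x\<close>, neither implication below holds: let \<open>x\<close> act on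
  \<open>\<int>/p \<times> \<int>/p\<^sup>2 \<times> \<dots> \<times> \<int>/p\<^sup>p\<close>, with generators \<open>u\<^sub>1, \<dots>, u\<^sub>p\<close>, by \<open>u\<^sub>k \<mapsto> u\<^sub>k + p u\<^sub>k\<^sub>+\<^sub>1\<close>.
  In this powerful semidirect product \<open>u\<^sub>1\<close> has order \<open>p\<close>, but \<open>(x u\<^sub>1)\<^sup>p \<noteq> x\<^sup>p\<close>.\<close>

definition pow_fibres :: "('a, 'b) monoid_scheme \<Rightarrow> nat \<Rightarrow> 'a set \<Rightarrow> nat \<Rightarrow> 'a set \<Rightarrow> bool" where
  "pow_fibres G p Z d H \<longleftrightarrow> (\<forall>i. \<forall>x\<in>H. \<forall>y\<in>H. x [^]\<^bsub>G\<^esub> (p ^ (i + d)) \<in> Z \<longrightarrow>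
     (y [^]\<^bsub>G\<^esub> (p ^ i) = \<one>\<^bsub>G\<^esub> \<longrightarrow> (x \<otimes>\<^bsub>G\<^esub> y) [^]\<^bsub>G\<^esub> (p ^ i) = x [^]\<^bsub>G\<^esub> (p ^ i)) \<and>
     (x [^]\<^bsub>G\<^esub> (p ^ i) = y [^]\<^bsub>G\<^esub> (p ^ i) \<longrightarrow> (inv\<^bsub>G\<^esub> x \<otimes>\<^bsub>G\<^esub> y) [^]\<^bsub>G\<^esub> (p ^ i) = \<one>\<^bsub>G\<^esub>))"

lemma pow_fibres_mult:
  "pow_fibres G p Z d H \<Longrightarrow> x \<in> H \<Longrightarrow> y \<in> H \<Longrightarrow> x [^]\<^bsub>G\<^esub> (p ^ (i + d)) \<in> Z \<Longrightarrow>
     y [^]\<^bsub>G\<^esub> (p ^ i) = \<one>\<^bsub>G\<^esub> \<Longrightarrow> (x \<otimes>\<^bsub>G\<^esub> y) [^]\<^bsub>G\<^esub> (p ^ i) = x [^]\<^bsub>G\<^esub> (p ^ i)"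
  unfolding pow_fibres_def by blast

lemma pow_fibres_diff:
  "pow_fibres G p Z d H \<Longrightarrow> x \<in> H \<Longrightarrow> y \<in> H \<Longrightarrow> x [^]\<^bsub>G\<^esub> (p ^ (i + d)) \<in> Z \<Longrightarrow>
     x [^]\<^bsub>G\<^esub> (p ^ i) = y [^]\<^bsub>G\<^esub> (p ^ i) \<Longrightarrow> (inv\<^bsub>G\<^esub> x \<otimes>\<^bsub>G\<^esub> y) [^]\<^bsub>G\<^esub> (p ^ i) = \<one>\<^bsub>G\<^esub>"
  unfolding pow_fibres_def by blast

lemma (in group) subgroup_pow_kernel:
  assumes H: "subgroup H G" and Z: "subgroup Z G" and "pow_fibres G p Z d H"
  shows "subgroup {x \<in> H. x [^] (p ^ i) = \<one>} G"
proof (rule subgroupI)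
  interpret H: subgroup H G by fact
  show "{x \<in> H. x [^] (p ^ i) = \<one>} \<subseteq> carrier G" using H.subset by blast
  have "\<one> \<in> {x \<in> H. x [^] (p ^ i) = \<one>}" using H.one_closed by simp
  then show "{x \<in> H. x [^] (p ^ i) = \<one>} \<noteq> {}" by blast
  fix a assume a: "a \<in> {x \<in> H. x [^] (p ^ i) = \<one>}"
  then show "inv a \<in> {x \<in> H. x [^] (p ^ i) = \<one>}" by (auto simp: nat_pow_inv)
  fix b assume b: "b \<in> {x \<in> H. x [^] (p ^ i) = \<one>}"
  \<comment> \<open>The side condition of \<open>pow_fibres\<close> holds trivially here, as
    \<open>a\<close> has order dividing p^i.\<close>
  have "a [^] (p ^ (i + d)) = (a [^] (p ^ i)) [^] (p ^ d)" using a H.mem_carrier by (simp add: power_add flip: nat_pow_pow)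
  also have "\<dots> \<in> Z" using a Z subgroup.one_closed by auto
  finally show "a \<otimes> b \<in> {x \<in> H. x [^] (p ^ i) = \<one>}"
    using pow_fibres_mult[OF assms(3), of a b i] a b by auto
qed

text \<open>Collects what the induction on the group order supplies: the claim for M with parameter
  1 and for each <u>M with unchanged parameter. The claim for the group itself is derived from
  these.\<close>

locale quasi_pow_step = quasi_pow +
  assumes d_le: "d \<le> 1"
    and fibres_P1: "pow_fibres G p Z 1 (P (Suc 0))"
    and fibres_L: "u \<in> carrier G \<Longrightarrow> pow_fibres G p Z d (L u)"
begin

text \<open>The elements of M of order dividing p^i; the claim for M makes them a normal subgroup of
  \<open>G\<close>, modulo which powers are compared.\<close>

definition N :: "nat \<Rightarrow> 'a set" where "N i = {x \<in> P (Suc 0). x [^] (p ^ i) = \<one>}"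

lemma N_normal: "N i \<lhd> G"
proof (rule normalI_conj)
  show "subgroup (N i) G" unfolding N_def
    using subgroup_pow_kernel[OF P_subgroup Z_subgroup fibres_P1] .
  fix n g assume n: "n \<in> N i" and g: "g \<in> carrier G"
  then have "inv g \<otimes> n \<otimes> g \<in> P (Suc 0)"
    using normal.inv_op_closed1[OF P_normal] by (auto simp: N_def)
  then show "inv g \<otimes> n \<otimes> g \<in> N i" using n g P_carrier by (auto simp: N_def conj_pow)
qed

lemma N_P1: "x \<in> N i \<Longrightarrow> x \<in> P (Suc 0)" by (simp add: N_def)

lemma N_carrier: "x \<in> N i \<Longrightarrow> x \<in> carrier G" using N_P1 P_carrier by blast

lemma N_pow: "x \<in> N i \<Longrightarrow> x [^] (p ^ i) = \<one>" by (simp add: N_def)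

lemma pow_N: "x \<in> N (Suc j) \<Longrightarrow> x [^] p \<in> N j"
  using subgroup_pow_closed[OF P_subgroup] P_carrier by (auto simp: N_def nat_pow_pow)

lemma one_Z: "\<one> \<in> Z" using Z_subgroup subgroup.one_closed by blast

lemma pow_Z_le:
  assumes "x \<in> carrier G" "x [^] (p ^ i) \<in> Z" "i \<le> j"
  shows "x [^] (p ^ j) \<in> Z"
proof -
  have "x [^] (p ^ j) = (x [^] (p ^ i)) [^] (p ^ (j - i))"
    using assms by (simp add: nat_pow_pow flip: power_add)
  then show ?thesis using subgroup_pow_closed[OF Z_subgroup assms(2)] by simp
qed

lemma N_Z: "x \<in> N i \<Longrightarrow> i \<le> j \<Longrightarrow> x [^] (p ^ j) \<in> Z"
  by (rule pow_Z_le[OF N_carrier]) (simp_all add: N_pow one_Z)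

lemma conj_mem_L: "x \<in> carrier G \<Longrightarrow> g \<in> carrier G \<Longrightarrow> inv g \<otimes> x \<otimes> g \<in> L x"
proof -
  assume a: "x \<in> carrier G" "g \<in> carrier G"
  then have "cmt G x g \<in> P (Suc 0)" by (intro P_cmt_le[of x 0 g 0]) auto
  then have "cmt G x g \<in> L x" using P1_subset_L by blast
  then have "x \<otimes> cmt G x g \<in> L x"
    using subgroup.m_closed[OF L_subgroup[OF a(1)] L_self] by blast
  then show ?thesis using a by (simp add: conj_eq_mult_cmt)
qed

text \<open>Both \<open>y\<close> and y^g lie in <y>M, and they have the same p^i-th power because
  \<open>g\<close> commutes with it. The claim for <y>M then bounds the order of their quotient
  [y,g].\<close>

lemma cmt_in_N:
  assumes y: "y \<in> carrier G" and g: "g \<in> carrier G"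
    and yZ: "y [^] (p ^ (i + d)) \<in> Z" and yg: "y [^] (p ^ i) \<otimes> g = g \<otimes> y [^] (p ^ i)"
  shows "cmt G y g \<in> N i"
proof -
  have "inv g \<otimes> y [^] (p ^ i) \<otimes> g = inv g \<otimes> (g \<otimes> y [^] (p ^ i))" using y g yg by (simp add: m_assoc)
  then have "(inv g \<otimes> y \<otimes> g) [^] (p ^ i) = y [^] (p ^ i)" using y g by (simp add: conj_pow)
  then have "(inv y \<otimes> (inv g \<otimes> y \<otimes> g)) [^] (p ^ i) = \<one>"
    using pow_fibres_diff[OF fibres_L[OF y] L_self conj_mem_L[OF y g] yZ] by simp
  moreover have "inv y \<otimes> (inv g \<otimes> y \<otimes> g) = cmt G y g" using y g by (simp add: word_simps)
  moreover have "cmt G y g \<in> P (Suc 0)" using y g by (intro P_cmt_le[of y 0 g 0]) auto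
  ultimately show ?thesis by (simp add: N_def)
qed

text \<open>The same comparison of \<open>c\<close> with c^g, now inside M with parameter 1: the
  side condition reads c^(p^(j+1)) \<in> Z, and this power is trivial.\<close>

lemma cmt_N_Suc:
  assumes c: "c \<in> N (Suc j)" and g: "g \<in> carrier G"
    and cg: "c [^] (p ^ j) \<otimes> g = g \<otimes> c [^] (p ^ j)"
  shows "cmt G c g \<in> N j"
proof -
  note cc = N_carrier[OF c]
  have "inv g \<otimes> c [^] (p ^ j) \<otimes> g = inv g \<otimes> (g \<otimes> c [^] (p ^ j))" using cc g cg by (simp add: m_assoc)
  then have "(inv g \<otimes> c \<otimes> g) [^] (p ^ j) = c [^] (p ^ j)" using cc g by (simp add: conj_pow)
  moreover have "inv g \<otimes> c \<otimes> g \<in> P (Suc 0)"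
    using normal.inv_op_closed1[OF P_normal g] N_P1[OF c] .
  ultimately have "(inv c \<otimes> (inv g \<otimes> c \<otimes> g)) [^] (p ^ j) = \<one>"
    using pow_fibres_diff[OF fibres_P1 N_P1[OF c], of "inv g \<otimes> c \<otimes> g" j] N_Z[OF c, of "j + 1"] by simp
  moreover have "inv c \<otimes> (inv g \<otimes> c \<otimes> g) = cmt G c g" using cc g by (simp add: word_simps)
  moreover have "cmt G c g \<in> P (Suc 0)" using cc g by (intro P_cmt_le[of c 0 g 0]) auto
  ultimately show ?thesis by (simp add: N_def)
qed

definition centralizes :: "nat \<Rightarrow> bool" where
  "centralizes k \<longleftrightarrow> (\<forall>v\<in>P k. v [^] p = \<one> \<longrightarrow>
     (\<forall>x\<in>carrier G. x [^] (p ^ k) \<in> Z \<longrightarrow> v \<otimes> x = x \<otimes> v))"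

text \<open>For s = [b,a], the element s^(p^j) has order dividing p and lies in
  \<open>P (k + j)\<close>, so \<open>centralizes\<close> makes it commute with \<open>a\<close> and
  \<open>b\<close>. Hence [s,a], [s,b] and s^p all lie in \<open>N j\<close>, which is what
  \<open>mult_pow_cong\<close> requires.\<close>

lemma pow_p_mult_N:
  assumes ab: "a \<in> carrier G" "b \<in> carrier G" and s: "cmt G b a \<in> P k" "cmt G b a \<in> N (Suc j)"
    and B: "centralizes (k + j)" and Z: "a [^] (p ^ (k + j)) \<in> Z" "b [^] (p ^ (k + j)) \<in> Z"
  shows "\<exists>n\<in>N j. (a \<otimes> b) [^] p = a [^] p \<otimes> b [^] p \<otimes> n"
proof -
  interpret N: normal "N j" G by (rule N_normal)
  let ?s = "cmt G b a"
  have "?s [^] (p ^ j) \<in> P (k + j)" using P_pow_pow[OF s(1)] .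
  moreover have "(?s [^] (p ^ j)) [^] p = \<one>"
    using N_pow[OF s(2)] N_carrier[OF s(2)] by (simp add: nat_pow_pow mult.commute)
  ultimately have "?s [^] (p ^ j) \<otimes> g = g \<otimes> ?s [^] (p ^ j)"
    if "g \<in> carrier G" "g [^] (p ^ (k + j)) \<in> Z" for g
    using B that unfolding centralizes_def by blast
  then have "cmt G ?s a \<in> N j" "cmt G ?s b \<in> N j" using cmt_N_Suc[OF s(2)] ab Z by auto
  then show ?thesis using N.mult_pow_cong[OF ab odd _ _ pow_N[OF s(2)]] by blast
qed

text \<open>With \<open>v = f\<^bsup>p^(j+1)\<^esup> z\<close> and \<open>f\<^sup>x = fb\<close>, it suffices to show that \<open>(fb)\<^sup>p\<close> and \<open>f\<^sup>p\<close> agree modulo \<open>N j\<close>.\<close>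

lemma centralizes_step:
  assumes B: "centralizes (Suc (Suc j))"
  shows "centralizes (Suc j)"
  unfolding centralizes_def
proof (intro ballI impI)
  interpret Z: subgroup Z G by (rule Z_subgroup)
  interpret N: normal "N i" G for i by (rule N_normal)
  fix v x assume v: "v \<in> P (Suc j)" "v [^] p = \<one>" and x: "x \<in> carrier G" "x [^] (p ^ Suc j) \<in> Z"
  obtain f z where f: "f \<in> carrier G" and z: "z \<in> Z" and vf: "v = f [^] (p ^ Suc j) \<otimes> z"
    using P_elem[OF v(1)] by blast
  have zc: "z \<in> carrier G" using z by simp
  let ?q = "f [^] (p ^ Suc j)"
  have "?q [^] p \<otimes> z [^] p = \<one>"
    using v(2) unfolding vf using commuting_pow[of ?q z p] f zc Z_central[OF z, of ?q] by simp
  then have "?q [^] p = inv (z [^] p)" using f zc by (simp add: inv_equality)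
  \<comment> \<open>The condition v^p = 1 turns f^(p^(j+2)) into the inverse of z^p, so
    \<open>f\<close> qualifies for the hypothesis \<open>centralizes (Suc (Suc j))\<close>.\<close>
  then have fZ: "f [^] (p ^ Suc (Suc j)) \<in> Z"
    using z f subgroup_pow_closed[OF Z_subgroup z] by (simp add: nat_pow_pow mult_ac)
  let ?b = "cmt G f x"
  have "cmt G x f \<in> N (Suc j)"
  proof (rule cmt_in_N[OF x(1) f])
    show "x [^] (p ^ (Suc j + d)) \<in> Z" using x by (rule pow_Z_le) simp
    show "x [^] (p ^ Suc j) \<otimes> f = f \<otimes> x [^] (p ^ Suc j)" using x(2) f by (rule Z_central)
  qed
  then have b: "?b \<in> N (Suc j)" using N.cmt_swap_mem[OF f x(1)] by simp
  have bc: "?b \<in> carrier G" using f x by simp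
  \<comment> \<open>As \<open>?b\<close> lies in M, its commutator with \<open>f\<close> lies in
    \<open>P 2\<close>. Thus the index \<open>k + j\<close> of \<open>pow_p_mult_N\<close> is 2 + j,
    exactly the case at hand.\<close>
  have "cmt G ?b f \<in> P (Suc (Suc 0))" using N_P1[OF b] f by (intro P_cmt_le[of _ "Suc 0" f 0]) auto
  moreover have "cmt G ?b f \<in> N (Suc j)" using N.cmt_mem(1)[OF b f] .
  moreover have "?b [^] (p ^ (Suc (Suc 0) + j)) \<in> Z" by (rule N_Z[OF b]) simp
  ultimately obtain n where n: "n \<in> N j" "(f \<otimes> ?b) [^] p = f [^] p \<otimes> ?b [^] p \<otimes> n"
    using pow_p_mult_N[OF f bc, of "Suc (Suc 0)" j] B fZ by auto
  have bn: "?b [^] p \<otimes> n \<in> N j" using N.m_closed pow_N[OF b] n(1) by blast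
  have fP: "f [^] p \<in> P (Suc 0)" using P_pow[of f 0] f by simp
  \<comment> \<open>The remaining p^j-th power is taken in M, where the claim with parameter 1
    removes the factor from \<open>N j\<close>; its side condition for f^p is
    \<open>fZ\<close>.\<close>
  have "(f \<otimes> ?b) [^] (p ^ Suc j) = ((f \<otimes> ?b) [^] p) [^] (p ^ j)"
    using f bc by (simp add: nat_pow_pow)
  also have "\<dots> = (f [^] p \<otimes> (?b [^] p \<otimes> n)) [^] (p ^ j)"
    unfolding n(2) using f bc N_carrier[OF n(1)] by (simp add: m_assoc)
  also have "\<dots> = (f [^] p) [^] (p ^ j)"
    using pow_fibres_mult[OF fibres_P1 fP N_P1[OF bn], of j] N_pow[OF bn] fZ f
    by (simp add: nat_pow_pow)
  also have "\<dots> = ?q" using f by (simp add: nat_pow_pow)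
  finally have "inv x \<otimes> ?q \<otimes> x = ?q"
    using f x by (simp add: conj_pow flip: conj_eq_mult_cmt)
  then have qx: "?q \<otimes> x = x \<otimes> ?q"
    using f x by (metis inv_solve_left m_assoc m_closed inv_closed nat_pow_closed)
  have "v \<otimes> x = ?q \<otimes> (z \<otimes> x)" unfolding vf using f x zc by (simp add: m_assoc)
  also have "\<dots> = (?q \<otimes> x) \<otimes> z" using f x zc Z_central[OF z x(1)] by (simp add: m_assoc)
  also have "\<dots> = x \<otimes> v" unfolding vf qx using f x zc by (simp add: m_assoc)
  finally show "v \<otimes> x = x \<otimes> v" .
qed

text \<open>The reverse induction starts where the series has become trivial.\<close>

lemma centralizes_Suc: "centralizes (Suc j)"
proof -
  obtain n where n: "P (Suc n) = {\<one>}" using P_eventually_trivial by blast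
  have big: "centralizes (Suc k)" if "n \<le> k" for k
    using P_antimono[of "Suc n" "Suc k"] that n by (auto simp: centralizes_def)
  show ?thesis
  proof (cases "n \<le> j")
    case False
    then have "j \<le> n" by simp
    then show ?thesis by (induction rule: inc_induct) (use big centralizes_step in auto)
  qed (rule big)
qed

text \<open>For i = j+1 a single p-th power is taken in \<open>G\<close>, with error in
  \<open>N j\<close>; the resulting p-th powers lie in M, where the claim for M handles the
  remaining exponent p^j.\<close>

lemma fibres_step: "pow_fibres G p Z d (carrier G)"
  unfolding pow_fibres_def
proof (intro allI ballI impI)
  fix i x y assume x: "x \<in> carrier G" and y: "y \<in> carrier G" and xZ: "x [^] (p ^ (i + d)) \<in> Z"
  show "(y [^] (p ^ i) = \<one> \<longrightarrow> (x \<otimes> y) [^] (p ^ i) = x [^] (p ^ i)) \<and>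
     (x [^] (p ^ i) = y [^] (p ^ i) \<longrightarrow> (inv x \<otimes> y) [^] (p ^ i) = \<one>)"
  proof (cases i)
    case (Suc j)
    interpret N: normal "N j" G by (rule N_normal)
    have pP: "g [^] p \<in> P (Suc 0)" if "g \<in> carrier G" for g using P_pow[of g 0] that by simp
    \<comment> \<open>Used with \<open>a\<close> equal to \<open>x\<close> for products and to its
      inverse for quotients. The commutator lies in \<open>P (Suc d)\<close>, so the exponent in
      \<open>centralizes\<close> is d+1+j = i+d, matching the side condition.\<close>
    have key: "\<exists>n\<in>N j. (a \<otimes> y) [^] p = a [^] p \<otimes> y [^] p \<otimes> n"
      if a: "a \<in> carrier G" and aZ: "a [^] (p ^ (i + d)) \<in> Z" and yZ: "y [^] (p ^ (i + d)) \<in> Z"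
        and ya: "y [^] (p ^ i) \<otimes> a = a \<otimes> y [^] (p ^ i)" for a
    proof (rule pow_p_mult_N[OF a y])
      show "cmt G y a \<in> P (Suc d)" using y a by (rule cmt_P)
      show "cmt G y a \<in> N (Suc j)" using cmt_in_N[OF y a yZ ya] Suc by simp
      have "Suc d + j = Suc (d + j)" by simp
      then show "centralizes (Suc d + j)" using centralizes_Suc by simp
      show "a [^] (p ^ (Suc d + j)) \<in> Z" "y [^] (p ^ (Suc d + j)) \<in> Z"
        using aZ yZ Suc by (simp_all add: add.commute)
    qed
    \<comment> \<open>Here \<open>d_le\<close> enters: x^(p^(j+2)) \<in> Z is the parameter-1 side
      condition for x^p in M.\<close>
    have xpZ: "(x [^] p) [^] (p ^ (j + 1)) \<in> Z"
      using pow_Z_le[OF x xZ, of "Suc (Suc j)"] d_le Suc x by (simp add: nat_pow_pow)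
    have "(x \<otimes> y) [^] (p ^ i) = x [^] (p ^ i)" if y1: "y [^] (p ^ i) = \<one>"
    proof -
      have "y [^] (p ^ (i + d)) \<in> Z" by (rule pow_Z_le[OF y, of i]) (use y1 one_Z in auto)
      then obtain n where n: "n \<in> N j" "(x \<otimes> y) [^] p = x [^] p \<otimes> y [^] p \<otimes> n"
        using key[OF x xZ] y1 x by auto
      have "y [^] p \<in> N j" using pP[OF y] y1 y Suc by (simp add: N_def nat_pow_pow)
      then have yn: "y [^] p \<otimes> n \<in> N j" using n by simp
      have "(x \<otimes> y) [^] (p ^ i) = (x [^] p \<otimes> (y [^] p \<otimes> n)) [^] (p ^ j)"
        using x y n N_carrier[OF n(1)] Suc by (simp add: m_assoc flip: nat_pow_pow)
      also have "\<dots> = (x [^] p) [^] (p ^ j)"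
        using pow_fibres_mult[OF fibres_P1 pP[OF x] N_P1[OF yn] xpZ N_pow[OF yn]] .
      finally show ?thesis using x Suc by (simp add: nat_pow_pow)
    qed
    moreover have "(inv x \<otimes> y) [^] (p ^ i) = \<one>" if xy: "x [^] (p ^ i) = y [^] (p ^ i)"
    proof -
      have ix: "inv x \<in> carrier G" using x by simp
      have "inv x [^] (p ^ (i + d)) \<in> Z"
        using subgroup.m_inv_closed[OF Z_subgroup xZ] x by (simp add: nat_pow_inv)
      moreover have "y [^] (p ^ (i + d)) \<in> Z"
        using xZ x y xy by (simp add: power_add flip: nat_pow_pow)
      moreover have "y [^] (p ^ i) \<otimes> inv x = inv x \<otimes> y [^] (p ^ i)"
        unfolding xy[symmetric] using x
        by (metis group.inv_closed group_axioms l_inv nat_pow_commute r_inv)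
      ultimately obtain n where n: "n \<in> N j" "(inv x \<otimes> y) [^] p = inv x [^] p \<otimes> y [^] p \<otimes> n"
        using key[OF ix] by auto
      have "(x [^] p) [^] (p ^ j) = (y [^] p) [^] (p ^ j)"
        using xy x y Suc by (simp add: nat_pow_pow)
      then have "(inv (x [^] p) \<otimes> y [^] p) [^] (p ^ j) = \<one>"
        by (rule pow_fibres_diff[OF fibres_P1 pP[OF x] pP[OF y] xpZ])
      moreover have "inv (x [^] p) \<otimes> y [^] p \<in> P (Suc 0)"
        using pP[OF x] pP[OF y] P_subgroup by (simp add: subgroup.m_closed subgroup.m_inv_closed)
      ultimately have "inv x [^] p \<otimes> y [^] p \<in> N j" using x by (simp add: N_def nat_pow_inv)
      then have "(inv x \<otimes> y) [^] p \<in> N j" unfolding n(2) using n(1) by (rule N.m_closed)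
      then show ?thesis using N_pow x y Suc by (simp flip: nat_pow_pow)
    qed
    ultimately show ?thesis by blast
  qed (use x y in auto)
qed

end

lemma (in quasi_pow) fibres_abelian:
  assumes comm: "\<And>x y. x \<in> carrier G \<Longrightarrow> y \<in> carrier G \<Longrightarrow> x \<otimes> y = y \<otimes> x"
  shows "pow_fibres G p Z d (carrier G)"
  unfolding pow_fibres_def
  using commuting_pow comm by (auto simp: nat_pow_inv)

text \<open>The parameter \<open>d\<close> varies in the induction because M is needed with
  parameter 1. Either some <u>M is everything and the group is abelian, or all of them are
  proper.\<close>

lemma pow_fibres_quasi_pow:
  "quasi_pow G p Z d \<Longrightarrow> d \<le> 1 \<Longrightarrow> pow_fibres G p Z d (carrier G)"
proof (induction "card (carrier G)" arbitrary: G d rule: less_induct)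
  case less
  interpret quasi_pow G p Z d by fact
  have sub: "pow_fibres G p Z e H"
    if H: "subgroup H G" "card H < card (carrier G)" "quasi_pow (G\<lparr>carrier := H\<rparr>) p Z e" "e \<le> 1" for H e
  proof -
    have "pow_fibres (G\<lparr>carrier := H\<rparr>) p Z e H"
      using less.hyps[of "G\<lparr>carrier := H\<rparr>" e] H by simp
    then show ?thesis using H(1) unfolding pow_fibres_def by (simp flip: nat_pow_consistent)
  qed
  show ?case
  proof (cases "\<exists>u\<in>carrier G. L u = carrier G")
    case True
    then show ?thesis using fibres_abelian abelian_if_L_eq by blast
  next
    case False
    then have L: "card (L u) < card (carrier G)" if "u \<in> carrier G" for u using card_L_less that by blast
    \<comment> \<open>M lies in \<open>L\<close> of the identity, which is proper, so the induction
      covers M as well.\<close>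
    have "card (P (Suc 0)) \<le> card (L \<one>\<^bsub>G\<^esub>)"
      using P1_subset_L subgroup.subset[OF L_subgroup[OF one_closed]] fin
      by (intro card_mono) (auto intro: finite_subset)
    then have "card (P (Suc 0)) < card (carrier G)" using L[OF one_closed] by simp
    then have "pow_fibres G p Z 1 (P (Suc 0))" by (intro sub P_subgroup quasi_pow_P1) auto
    moreover have "pow_fibres G p Z d (L u)" if "u \<in> carrier G" for u
      using that L less.prems by (intro sub L_subgroup quasi_pow_L) auto
    ultimately interpret quasi_pow_step G p Z d using less.prems by unfold_locales auto
    show ?thesis by (rule fibres_step)
  qed
qed

section \<open>The index of the subgroup of powers\<close>

context quasi_pow
begin

text \<open>With \<open>D\<close> the kernel of x \<mapsto> x^q modulo \<open>T\<close>, |G| = |D|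
  |R:T|, so the claim reduces to |D| = |T| |K|. The formula for M gives |M| = |T| |K \<inter> M|,
  and it remains to see that \<open>K\<close> meets every coset of M in \<open>D\<close>.\<close>

lemma pow_index_step:
  assumes d: "d \<le> 1"
    and IHM: "card (P (Suc 0)) = card {x [^] (p ^ i) | x. x \<in> P (Suc 0)} * card {x \<in> P (Suc 0). x [^] (p ^ i) = \<one>}"
    and IHL: "\<And>u. u \<in> carrier G \<Longrightarrow>
      card (L u) = card {x [^] (p ^ i) | x. x \<in> L u} * card {x \<in> L u. x [^] (p ^ i) = \<one>}"
  shows "order G = card {x [^] (p ^ i) | x. x \<in> carrier G} * card {x \<in> carrier G. x [^] (p ^ i) = \<one>}"
proof -
  define q where "q = p ^ i"
  define M where "M = P (Suc 0)"
  define T where "T = P (Suc i)"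
  define R where "R = {x [^] q | x. x \<in> carrier G}"
  define D where "D = {x \<in> carrier G. x [^] q \<in> T}"
  define K where "K = {x \<in> carrier G. x [^] q = \<one>}"
  interpret T: normal T G unfolding T_def by (rule P_normal)
  interpret M: normal M G unfolding M_def by (rule P_normal)
  have finite_sub: "finite H" if "subgroup H G" for H
    using finite_subset[OF subgroup.subset[OF that] fin] .
  have T_eq: "T = {x [^] q | x. x \<in> M}" unfolding T_def M_def q_def by (rule P_Suc_eq)
  have R: "subgroup R G" unfolding R_def q_def
    by (rule pow_set_subgroup[OF subgroup_self bspec[OF bspec[OF pow_mult[OF quasi_pow_axioms]]]])
  have K: "subgroup K G" unfolding K_def q_def
    by (rule subgroup_pow_kernel[OF subgroup_self Z_subgroup pow_fibres_quasi_pow[OF quasi_pow_axioms d]])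
  have cong: "\<exists>n\<in>T. (x \<otimes> y) [^] q = x [^] q \<otimes> y [^] q \<otimes> n" if "x \<in> carrier G" "y \<in> carrier G" for x y
    unfolding T_def q_def using pow_mult_cong[OF that] .
  have mult_T: "(x \<otimes> y) [^] q \<in> T \<longleftrightarrow> x [^] q \<otimes> y [^] q \<in> T"
    if xy: "x \<in> carrier G" "y \<in> carrier G" for x y
  proof -
    obtain n where n: "n \<in> T" "(x \<otimes> y) [^] q = x [^] q \<otimes> y [^] q \<otimes> n" using cong[OF xy] by blast
    have nc: "n \<in> carrier G" using n by simp
    have "x [^] q \<otimes> y [^] q = (x \<otimes> y) [^] q \<otimes> inv n" using n nc xy by (simp add: m_assoc)
    then show ?thesis using n T.m_closed T.m_inv_closed by metis
  qed
  have D: "subgroup D G"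
  proof (rule subgroupI)
    have "\<one> \<in> D" by (simp add: D_def)
    then show "D \<noteq> {}" by blast
    fix a assume a: "a \<in> D"
    then show "inv a \<in> D" by (simp add: D_def nat_pow_inv)
    fix b assume b: "b \<in> D"
    show "a \<otimes> b \<in> D" using a b mult_T[of a b] by (simp add: D_def)
  qed (auto simp: D_def)
  have KD: "K \<subseteq> D" by (auto simp: K_def D_def)
  have MD: "M \<subseteq> D" using T_eq by (auto simp: D_def)

  have G_eq: "card (carrier G) = card D * card ((\<lambda>x. T #> x [^] q) ` carrier G)"
  proof (rule card_eq_kernel_times_image[OF subgroup_self fin])
    show "D \<subseteq> carrier G" by (auto simp: D_def)
    fix a b assume ab: "a \<in> carrier G" "b \<in> carrier G"
    then show "T #> a [^] q = T #> b [^] q \<longleftrightarrow> a \<otimes> inv b \<in> D"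
      using mult_T[of a "inv b"] coset_eq_iff[OF T.is_subgroup, of "a [^] q" "b [^] q"]
      by (simp add: D_def nat_pow_inv)
  qed
  have "T \<subseteq> R" using T_eq by (auto simp: R_def)
  moreover have "(\<lambda>x. T #> x) ` R = (\<lambda>x. T #> x [^] q) ` carrier G" by (auto simp: R_def)
  ultimately have R_eq: "card R = card T * card ((\<lambda>x. T #> x [^] q) ` carrier G)"
    using card_eq_inter_times_cosets[OF R finite_sub[OF R] T.is_subgroup] by (simp add: Int_absorb1)
  have D_eq: "card D = card M * card ((\<lambda>x. M #> x) ` D)"
    using card_eq_inter_times_cosets[OF D finite_sub[OF D] M.is_subgroup] MD by (simp add: Int_absorb1)
  have K_eq: "card K = card (K \<inter> M) * card ((\<lambda>x. M #> x) ` K)"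
    by (rule card_eq_inter_times_cosets[OF K finite_sub[OF K] M.is_subgroup])
  have KM: "{x \<in> M. x [^] q = \<one>} = K \<inter> M" by (auto simp: K_def)
  have M_eq: "card M = card T * card (K \<inter> M)"
    using IHM unfolding T_eq KM[symmetric] by (simp add: q_def M_def)

  have coset: "M #> x \<in> (\<lambda>x. M #> x) ` K" if x: "x \<in> D" for x
  proof -
    have xc: "x \<in> carrier G" using x by (simp add: D_def)
    note LS = L_subgroup[OF xc]
    have M_L: "M \<subseteq> L x" unfolding M_def by (rule P1_subset_L)
    have "L x \<subseteq> D" unfolding L_def
      using x MD by (intro generate_subgroup_incl D) (auto simp: M_def)
    \<comment> \<open>The q-th powers of M already fill \<open>T\<close>, and those of
      \<open>D\<close> stay in \<open>T\<close>; so <x>M has the same set of q-th powers as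
      M.\<close>
    then have "{l [^] q | l. l \<in> L x} = T" using M_L T_eq by (auto simp: D_def)
    moreover have KL: "{l \<in> L x. l [^] q = \<one>} = K \<inter> L x"
      using subgroup.subset[OF LS] by (auto simp: K_def)
    ultimately have "card (L x) = card T * card (K \<inter> L x)"
      using IHL[OF xc] by (simp add: q_def)
    moreover have "card (L x) = card M * card ((\<lambda>x. M #> x) ` L x)"
      using card_eq_inter_times_cosets[OF LS finite_sub[OF LS] M.is_subgroup] M_L
      by (simp add: Int_absorb1)
    moreover have "card (K \<inter> L x) = card (K \<inter> M) * card ((\<lambda>x. M #> x) ` (K \<inter> L x))"
    proof -
      have S: "subgroup (K \<inter> L x) G" by (rule subgroups_Inter_pair[OF K LS])
      have "K \<inter> L x \<inter> M = K \<inter> M" using M_L by blast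
      then show ?thesis using card_eq_inter_times_cosets[OF S finite_sub[OF S] M.is_subgroup] by simp
    qed
    moreover have "card M > 0"
      using finite_sub[OF M.is_subgroup] M.one_closed card_gt_0_iff by blast
    \<comment> \<open>Substituting |M| = |T| |K \<inter> M| gives two expressions for |<x>M|;
      cancelling |M| shows that \<open>K\<close> meets each coset of M in <x>M, in particular that
      of \<open>x\<close>.\<close>
    ultimately have "card ((\<lambda>x. M #> x) ` (K \<inter> L x)) = card ((\<lambda>x. M #> x) ` L x)"
      using M_eq by (simp add: mult.assoc)
    then have "(\<lambda>x. M #> x) ` (K \<inter> L x) = (\<lambda>x. M #> x) ` L x"
      using finite_sub[OF LS] by (intro card_subset_eq) auto
    then show ?thesis using L_self[of x] by blast
  qed
  then have "(\<lambda>x. M #> x) ` D = (\<lambda>x. M #> x) ` K" using KD by blast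
  then have "card (carrier G) = card R * card K"
    using G_eq R_eq D_eq K_eq M_eq by simp
  then show ?thesis by (simp add: order_def R_def K_def q_def)
qed

end

lemma pow_index:
  "quasi_pow G p Z d \<Longrightarrow> d \<le> 1 \<Longrightarrow> order G = card {x [^]\<^bsub>G\<^esub> (p ^ i) | x. x \<in> carrier G} *
    card {x \<in> carrier G. x [^]\<^bsub>G\<^esub> (p ^ i) = \<one>\<^bsub>G\<^esub>}"
proof (induction "card (carrier G)" arbitrary: G d rule: less_induct)
  case less
  interpret quasi_pow G p Z d by fact
  have sub: "card H = card {x [^]\<^bsub>G\<^esub> (p ^ i) | x. x \<in> H} * card {x \<in> H. x [^]\<^bsub>G\<^esub> (p ^ i) = \<one>\<^bsub>G\<^esub>}"
    if H: "card H < card (carrier G)" "quasi_pow (G\<lparr>carrier := H\<rparr>) p Z e" "e \<le> 1" for H e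
    using less.hyps[of "G\<lparr>carrier := H\<rparr>" e] H by (simp add: order_def flip: nat_pow_consistent)
  show ?case
  proof (cases "\<exists>u\<in>carrier G. L u = carrier G")
    case True
    then have comm: "x \<otimes>\<^bsub>G\<^esub> y = y \<otimes>\<^bsub>G\<^esub> x" if "x \<in> carrier G" "y \<in> carrier G" for x y
      using abelian_if_L_eq that by blast
    have "card (carrier G) = card {x \<in> carrier G. x [^]\<^bsub>G\<^esub> (p ^ i) = \<one>\<^bsub>G\<^esub>}
        * card ((\<lambda>x. x [^]\<^bsub>G\<^esub> (p ^ i)) ` carrier G)"
    proof (rule card_eq_kernel_times_image[OF subgroup_self fin])
      fix a b assume ab: "a \<in> carrier G" "b \<in> carrier G"
      then have "(a \<otimes>\<^bsub>G\<^esub> inv\<^bsub>G\<^esub> b) [^]\<^bsub>G\<^esub> (p ^ i) = a [^]\<^bsub>G\<^esub> (p ^ i) \<otimes>\<^bsub>G\<^esub> inv\<^bsub>G\<^esub> (b [^]\<^bsub>G\<^esub> (p ^ i))"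
        using commuting_pow comm by (simp add: nat_pow_inv)
      then show "a [^]\<^bsub>G\<^esub> (p ^ i) = b [^]\<^bsub>G\<^esub> (p ^ i) \<longleftrightarrow>
          a \<otimes>\<^bsub>G\<^esub> inv\<^bsub>G\<^esub> b \<in> {x \<in> carrier G. x [^]\<^bsub>G\<^esub> (p ^ i) = \<one>\<^bsub>G\<^esub>}"
        using ab by (simp add: mult_inv_eq_one_iff)
    qed auto
    moreover have "{x [^]\<^bsub>G\<^esub> (p ^ i) | x. x \<in> carrier G} = (\<lambda>x. x [^]\<^bsub>G\<^esub> (p ^ i)) ` carrier G" by auto
    ultimately show ?thesis by (simp add: order_def mult.commute)
  next
    case False
    then have L: "card (L u) < card (carrier G)" if "u \<in> carrier G" for u using card_L_less that by blast
    have "card (P (Suc 0)) \<le> card (L \<one>\<^bsub>G\<^esub>)"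
      using P1_subset_L subgroup.subset[OF L_subgroup[OF one_closed]] fin
      by (intro card_mono) (auto intro: finite_subset)
    then have "card (P (Suc 0)) < card (carrier G)" using L[OF one_closed] by simp
    then show ?thesis
      using L less.prems sub[OF _ quasi_pow_P1] sub[OF _ quasi_pow_L]
      by (intro pow_index_step) auto
  qed
qed

section \<open>From quasi-powerful groups to the theorem\<close>

lemma (in group) subgroup_group_center: "subgroup (group_center G) G"
proof (rule subgroupI)
  fix a assume a: "a \<in> group_center G"
  then have ac: "a \<in> carrier G" by (simp add: group_center_def)
  have "inv a \<otimes> g = g \<otimes> inv a" if g: "g \<in> carrier G" for g
  proof -
    have "a \<otimes> g = g \<otimes> a" using a g by (simp add: group_center_def)
    then have "inv a \<otimes> (g \<otimes> a) \<otimes> inv a = inv a \<otimes> (a \<otimes> g) \<otimes> inv a" by simp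
    then show ?thesis using ac g by (simp add: m_assoc)
  qed
  then show "inv a \<in> group_center G" using a by (simp add: group_center_def)
  fix b assume b: "b \<in> group_center G"
  then have bc: "b \<in> carrier G" by (simp add: group_center_def)
  have "a \<otimes> b \<otimes> g = g \<otimes> (a \<otimes> b)" if g: "g \<in> carrier G" for g
  proof -
    have ag: "a \<otimes> g = g \<otimes> a" and bg: "b \<otimes> g = g \<otimes> b" using a b g by (simp_all add: group_center_def)
    have "a \<otimes> b \<otimes> g = a \<otimes> g \<otimes> b" using ac bc g bg by (simp add: m_assoc)
    also have "\<dots> = g \<otimes> (a \<otimes> b)" unfolding ag using ac bc g by (simp add: m_assoc)
    finally show ?thesis .
  qed
  then show "a \<otimes> b \<in> group_center G" using ac bc by (auto simp: group_center_def)
next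
  have "\<one> \<in> group_center G" by (simp add: group_center_def)
  then show "group_center G \<noteq> {}" by blast
qed (auto simp: group_center_def)

text \<open>The p-th powers in G/Z(G) lie in the image of G^p Z(G), which is \<open>P 1\<close> and
  contains the centre. The inclusion for the quotient therefore lifts to [G,G] \<le>
  \<open>P 1\<close>, the case \<open>d = 0\<close>.\<close>

lemma quasi_pow_of_quasi_powerful:
  assumes "Factorial_Ring.prime p" "odd p" "p_group p G" "quasi_powerful p G"
  shows "quasi_pow G p (group_center G) 0"
proof -
  interpret group G using assms(3) by (simp add: p_group_def)
  let ?C = "group_center G"
  have central: "z \<otimes>\<^bsub>G\<^esub> g = g \<otimes>\<^bsub>G\<^esub> z" if "z \<in> ?C" "g \<in> carrier G" for z g
    using that by (simp add: group_center_def)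
  interpret p_group_central G p ?C
    using assms subgroup_group_center central
    by (intro p_group_central.intro p_group_central_axioms.intro is_group) (auto simp: p_group_def)
  interpret C: normal ?C G
  proof (rule normalI_conj[OF subgroup_group_center])
    fix n g assume n: "n \<in> ?C" and g: "g \<in> carrier G"
    then have "inv\<^bsub>G\<^esub> g \<otimes>\<^bsub>G\<^esub> n \<otimes>\<^bsub>G\<^esub> g = n"
      using central[of n g] Z_subset by (auto simp: m_assoc)
    then show "inv\<^bsub>G\<^esub> g \<otimes>\<^bsub>G\<^esub> n \<otimes>\<^bsub>G\<^esub> g \<in> ?C" using n by simp
  qed
  let ?Q = "G Mod ?C" and ?h = "\<lambda>x. ?C #>\<^bsub>G\<^esub> x"
  interpret h: group_hom G ?Q ?h
    by (intro group_hom.intro group_hom_axioms.intro is_group C.factorgroup_is_group C.r_coset_hom_Mod)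
  have cQ: "carrier ?Q = ?h ` carrier G" by (simp add: carrier_FactGroup)
  have "pow_subgroup ?Q p \<subseteq> ?h ` P (Suc 0)"
    unfolding pow_subgroup_def
  proof (rule h.H.generate_subgroup_incl[OF _ h.subgroup_img_is_subgroup[OF P_subgroup]])
    show "{g [^]\<^bsub>?Q\<^esub> p | g. g \<in> carrier ?Q} \<subseteq> ?h ` P (Suc 0)"
    proof
      fix y assume "y \<in> {g [^]\<^bsub>?Q\<^esub> p | g. g \<in> carrier ?Q}"
      then obtain x where x: "x \<in> carrier G" "y = ?h x [^]\<^bsub>?Q\<^esub> p" unfolding cQ by blast
      then have "y = ?h (x [^]\<^bsub>G\<^esub> p)" by (simp add: h.hom_nat_pow)
      then show "y \<in> ?h ` P (Suc 0)" using P_pow[of x 0] x by simp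
    qed
  qed
  then have der: "derived ?Q (carrier ?Q) \<subseteq> ?h ` P (Suc 0)"
    using assms(4) unfolding quasi_powerful_def powerful_def by blast
  have "cmt G x y \<in> P (Suc 0)" if xy: "x \<in> carrier G" "y \<in> carrier G" for x y
  proof -
    \<comment> \<open>The library's \<open>derived\<close> uses commutators x y x^-1 y^-1; inserting
      inverses turns these into \<open>cmt\<close>.\<close>
    have "?h (inv\<^bsub>G\<^esub> x) \<otimes>\<^bsub>?Q\<^esub> ?h (inv\<^bsub>G\<^esub> y) \<otimes>\<^bsub>?Q\<^esub> inv\<^bsub>?Q\<^esub> ?h (inv\<^bsub>G\<^esub> x) \<otimes>\<^bsub>?Q\<^esub> inv\<^bsub>?Q\<^esub> ?h (inv\<^bsub>G\<^esub> y)
        \<in> derived ?Q (carrier ?Q)"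
      unfolding derived_def
      using xy by (intro generate.incl UN_I[OF h.hom_closed[of "inv\<^bsub>G\<^esub> x"]]
        UN_I[OF h.hom_closed[of "inv\<^bsub>G\<^esub> y"]] singletonI inv_closed)
    also have "?h (inv\<^bsub>G\<^esub> x) \<otimes>\<^bsub>?Q\<^esub> ?h (inv\<^bsub>G\<^esub> y) \<otimes>\<^bsub>?Q\<^esub> inv\<^bsub>?Q\<^esub> ?h (inv\<^bsub>G\<^esub> x) \<otimes>\<^bsub>?Q\<^esub> inv\<^bsub>?Q\<^esub> ?h (inv\<^bsub>G\<^esub> y)
        = ?h (cmt G x y)"
      unfolding cmt_def using xy by (simp del: mult_FactGroup)
    finally obtain m where m: "m \<in> P (Suc 0)" "?h (cmt G x y) = ?h m" using der by blast
    obtain n where n: "n \<in> ?C" "cmt G x y = m \<otimes>\<^bsub>G\<^esub> n"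
      using C.coset_eqE[OF m(2)] xy P_carrier[OF m(1)] by auto
    then show ?thesis
      using subgroup.m_closed[OF P_subgroup m(1)] Z_subset_P1 by auto
  qed
  then show ?thesis by unfold_locales
qed

theorem theorem1:
  fixes p :: nat and G :: "('a, 'b) monoid_scheme"
  assumes "Factorial_Ring.prime p" and "odd p"
    and "p_group p G"
    and "quasi_powerful p G"
  shows "(\<forall>i::nat. \<forall>a \<in> carrier G. \<forall>b \<in> carrier G.
            group.ord G a \<le> p ^ i \<longrightarrow> group.ord G b \<le> p ^ i \<longrightarrow>
            group.ord G (a \<otimes>\<^bsub>G\<^esub> b) \<le> p ^ i)
       \<and> (\<forall>i::nat. pow_subgroup G (p ^ i) = {g [^]\<^bsub>G\<^esub> (p ^ i) | g. g \<in> carrier G})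
       \<and> (\<forall>i::nat. card (rcosets\<^bsub>G\<^esub> (pow_subgroup G (p ^ i))) = card (Omega G (p ^ i)))
       \<and> regular_power_structure p G"
proof -
  let ?C = "group_center G"
  have q: "quasi_pow G p ?C 0" using assms by (rule quasi_pow_of_quasi_powerful)
  interpret quasi_pow G p ?C 0 by (rule q)
  let ?K = "\<lambda>i. {x \<in> carrier G. x [^]\<^bsub>G\<^esub> (p ^ i) = \<one>\<^bsub>G\<^esub>}"
  let ?R = "\<lambda>i. {g [^]\<^bsub>G\<^esub> (p ^ i) | g. g \<in> carrier G}"
  obtain n where n: "order G = p ^ n" using ord by (elim exE)
  have ord_le: "group.ord G g \<le> p ^ i \<longleftrightarrow> g \<in> ?K i" if g: "g \<in> carrier G" for g i
  proof -
    have "group.ord G g dvd p ^ n" using ord_dvd_group_order[OF g] n by simp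
    then obtain m where m: "group.ord G g = p ^ m" using divides_primepow_nat[OF prime] by blast
    \<comment> \<open>Orders are powers of \<open>p\<close>, so being at most p^i is the same as
      dividing it.\<close>
    have "p ^ m \<le> p ^ i \<longleftrightarrow> p ^ m dvd p ^ i"
      using prime_ge_2_nat[OF prime] by (simp add: dvd_power_iff_le)
    then show ?thesis using g m pow_eq_id[OF g, of "p ^ i"] by simp
  qed
  have K: "subgroup (?K i) G" for i
    by (rule subgroup_pow_kernel[OF subgroup_self Z_subgroup pow_fibres_quasi_pow[OF q]]) simp
  have R: "subgroup (?R i) G" for i
    by (rule pow_set_subgroup[OF subgroup_self bspec[OF bspec[OF pow_mult[OF q]]]])
  have gen: "generate G H = H" if "subgroup H G" for H
    using that generate_subgroup_incl[of H H] by (auto intro: generate.incl)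
  have Om: "Omega G (p ^ i) = ?K i" for i unfolding Omega_def using gen[OF K] .
  have Pw: "pow_subgroup G (p ^ i) = ?R i" for i unfolding pow_subgroup_def using gen[OF R] .
  have idx: "card (rcosets\<^bsub>G\<^esub> (pow_subgroup G (p ^ i))) = card (Omega G (p ^ i))" for i
  proof -
    \<comment> \<open>Lagrange and \<open>pow_index\<close> both express the group order with the
      factor |R|, which cancels.\<close>
    have "card (rcosets\<^bsub>G\<^esub> ?R i) * card (?R i) = card (?K i) * card (?R i)"
      using lagrange[OF R] pow_index[OF q, of i] by (simp add: mult.commute)
    moreover have "card (?R i) > 0"
      using finite_subset[OF subgroup.subset[OF R] fin] subgroup.one_closed[OF R] card_gt_0_iff by blast
    ultimately show ?thesis unfolding Om Pw by simp
  qed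
  have "\<forall>i. \<forall>a \<in> carrier G. \<forall>b \<in> carrier G. group.ord G a \<le> p ^ i \<longrightarrow> group.ord G b \<le> p ^ i \<longrightarrow>
      group.ord G (a \<otimes>\<^bsub>G\<^esub> b) \<le> p ^ i"
  proof (intro allI ballI impI)
    fix i a b assume ab: "a \<in> carrier G" "b \<in> carrier G"
      and "group.ord G a \<le> p ^ i" "group.ord G b \<le> p ^ i"
    then have "a \<otimes>\<^bsub>G\<^esub> b \<in> ?K i" using ord_le[OF ab(1)] ord_le[OF ab(2)] subgroup.m_closed[OF K] by simp
    then show "group.ord G (a \<otimes>\<^bsub>G\<^esub> b) \<le> p ^ i" using ord_le ab by simp
  qed
  moreover have "Omega G (p ^ i) = {g \<in> carrier G. group.ord G g \<le> p ^ i}" for i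
    unfolding Om using ord_le by blast
  ultimately show ?thesis
    unfolding regular_power_structure_def using Pw idx by blast
qed

end
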